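(* Let $\Omega\subset\mathbb{S}^2$ be a domain (connected open set) with smooth boundary, let $p\in[0,1)\cup(1,3]$, and let $u\in C^\infty(\overline\Omega)$ be a solution of $-\Delta u=u^p$ in $\Omega$, $u>0$ in $\Omega$, $u=0$ on $\partial\Omega$. Let $v=u^{\frac{1-p}{2}}$ and let $\nabla^2 v$ be its covariant Hessian. Suppose that (a) if $0\le p<1$, $\nabla^2 v$ is negative semidefinite at every point of $\Omega$; (b) if $1<p\le 3$, $\nabla^2 v$ is positive semidefinite at every point of $\Omega$. Then the rank of $\nabla^2 v$ is constant in $\Omega$.
   Context: $\mathbb{S}^2$ is the unit sphere with its round metric of curvature $1$, $\Delta$ the Laplace–Beltrami operator, and $\nabla^2 v$ the covariant Hessian, $\nabla^2 v(X,Y)=Y(Xv)-(\nabla_YX)v$, a symmetric bilinear form on each tangent space whose rank and definiteness are frame-independent. *)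

theory Defs
  imports "HOL-Analysis.Analysis"
begin

abbreviation S2 :: "(real^3) set" where "S2 \<equiv> sphere 0 1"

text \<open>C-infinity on an open set U of real^3: there is a family D of all iterated
directional derivatives (D [h_k,...,h_1] = derivative in direction h_k of ... of f),
each Frechet differentiable on U with derivative given by the next one.\<close>
definition smooth_on :: "(real^3) set \<Rightarrow> (real^3 \<Rightarrow> real) \<Rightarrow> bool" where
  "smooth_on U f \<longleftrightarrow> (\<exists>D :: (real^3) list \<Rightarrow> real^3 \<Rightarrow> real.
      (\<forall>x\<in>U. D [] x = f x) \<and>
      (\<forall>ds. \<forall>x\<in>U. (D ds has_derivative (\<lambda>h. D (h # ds) x)) (at x)))"

definition smooth_on_closure :: "(real^3) set \<Rightarrow> (real^3 \<Rightarrow> real) \<Rightarrow> bool" where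
  "smooth_on_closure \<Omega> u \<longleftrightarrow> (\<exists>U g. open U \<and> closure \<Omega> \<subseteq> U \<and> smooth_on U g \<and>
      (\<forall>x\<in>closure \<Omega>. g x = u x))"

definition smooth_domain_S2 :: "(real^3) set \<Rightarrow> bool" where
  "smooth_domain_S2 \<Omega> \<longleftrightarrow> \<Omega> \<noteq> {} \<and> connected \<Omega> \<and> openin (top_of_set S2) \<Omega> \<and>
     (\<forall>q \<in> closure \<Omega> - \<Omega>. \<exists>W \<rho> L. open W \<and> q \<in> W \<and> smooth_on W \<rho> \<and>
        (\<rho> has_derivative L) (at q) \<and> (\<exists>X. X \<bullet> q = 0 \<and> L X \<noteq> 0) \<and>
        \<Omega> \<inter> W = {x \<in> S2 \<inter> W. \<rho> x < 0})"

text \<open>Unit-speed-scaled great circle: the geodesic t \<mapsto> exp_x(t X) of S^2.\<close>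
definition geod :: "real^3 \<Rightarrow> real^3 \<Rightarrow> real \<Rightarrow> real^3" where
  "geod x X t = cos (t * norm X) *\<^sub>R x + sin (t * norm X) *\<^sub>R (X /\<^sub>R norm X)"

text \<open>Covariant Hessian of f on S^2 at x: the quadratic form is the second derivative of
f along geodesics (nabla^2 f(X,X) = (f o exp_x(tX))''(0)), the bilinear form by
polarisation. X, Y range over the tangent plane {X. X . x = 0}.\<close>
definition hess_quad :: "(real^3 \<Rightarrow> real) \<Rightarrow> real^3 \<Rightarrow> real^3 \<Rightarrow> real" where
  "hess_quad f x X = deriv (deriv (\<lambda>t. f (geod x X t))) 0"

definition cov_hess :: "(real^3 \<Rightarrow> real) \<Rightarrow> real^3 \<Rightarrow> real^3 \<Rightarrow> real^3 \<Rightarrow> real" where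
  "cov_hess f x X Y = (hess_quad f x (X + Y) - hess_quad f x (X - Y)) / 4"

definition tangent_S2 :: "real^3 \<Rightarrow> (real^3) set" where
  "tangent_S2 x = {X. X \<bullet> x = 0}"

definition lb_laplacian :: "(real^3 \<Rightarrow> real) \<Rightarrow> real^3 \<Rightarrow> real" where
  "lb_laplacian f x = (let (e1, e2) = (SOME (e1, e2). e1 \<in> tangent_S2 x \<and> e2 \<in> tangent_S2 x
        \<and> norm e1 = 1 \<and> norm e2 = 1 \<and> e1 \<bullet> e2 = 0)
      in cov_hess f x e1 e1 + cov_hess f x e2 e2)"

definition hess_rank :: "(real^3 \<Rightarrow> real) \<Rightarrow> real^3 \<Rightarrow> nat" where
  "hess_rank f x = 2 - dim {X \<in> tangent_S2 x. \<forall>Y \<in> tangent_S2 x. cov_hess f x X Y = 0}"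

end

theory Submission
  imports Defs
begin

text \<open>
  The Hessian of \<open>v\<close> has rank 2 everywhere. Put \<open>\<gamma> = (1 - p) / 2\<close>, so that \<open>v = u powr \<gamma>\<close> satisfies
  \<open>v \<Delta>v + c |\<nabla>v|\<^sup>2 + d = 0\<close> with \<open>c = (1 - \<gamma>) / \<gamma>\<close> and \<open>d = \<gamma>\<close>. By semidefiniteness
  \<open>\<phi> = det \<nabla>\<^sup>2v\<close> is nonnegative, so a zero of \<open>\<phi>\<close> is a minimum, where \<open>\<nabla>\<phi> = 0\<close> and
  \<open>\<Delta>\<phi> \<ge> 0\<close>. In an orthonormal frame there in which \<open>\<nabla>\<^sup>2v\<close> is diagonal with entries
  \<open>G = \<Delta>v \<noteq> 0\<close> and \<open>0\<close>, differentiating the equation for \<open>v\<close> twice in the null direction 2 gives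
  \<open>\<Delta>\<phi> = 2 G ((c + 2) v\<^sub>2\<^sup>2 + d) / v - 2 |\<nabla>v|\<^sup>2\<close>. Since \<open>v G = - c |\<nabla>v|\<^sup>2 - d\<close>,
  this is negative both when \<open>c \<ge> 0, d > 0\<close> (the case \<open>p < 1\<close>) and when \<open>c \<le> -2, d < 0\<close>
  (the case \<open>1 < p \<le> 3\<close>), a contradiction. All derivatives are taken in geographic coordinates
  centred at the point, with the null direction tangent to the meridian.
\<close>

section \<open>Families of iterated directional derivatives\<close>

text \<open>\<open>D []\<close> is the function itself, and the head of a list is the direction
  taken last. Leaving out the function that \<open>smooth_on\<close> mentions lets one fixed family
  serve as notation for all derivatives.\<close>

definition deriv_family :: "(real^3) set \<Rightarrow> ((real^3) list \<Rightarrow> real^3 \<Rightarrow> real) \<Rightarrow> bool" where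
  "deriv_family U D \<longleftrightarrow> (\<forall>ds. \<forall>x\<in>U. (D ds has_derivative (\<lambda>h. D (h # ds) x)) (at x))"

lemma deriv_familyD:
  "deriv_family U D \<Longrightarrow> x \<in> U \<Longrightarrow> (D ds has_derivative (\<lambda>h. D (h # ds) x)) (at x)"
  by (auto simp: deriv_family_def)

lemma deriv_family_subset: "deriv_family U D \<Longrightarrow> W \<subseteq> U \<Longrightarrow> deriv_family W D"
  by (auto simp: deriv_family_def)

lemma deriv_family_linear:
  assumes "deriv_family U D" "x \<in> U"
  shows "linear (\<lambda>h. D (h # ds) x)"
  using deriv_familyD[OF assms] by (rule has_derivative_linear)

lemma deriv_family_isCont:
  assumes "deriv_family U D" "x \<in> U"
  shows "isCont (D ds) x"
  using deriv_familyD[OF assms] has_derivative_continuous by blast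

text \<open>Frechet derivatives on an open set are unique, so an identity between members of the
  family may be differentiated.\<close>

lemma deriv_family_cong:
  assumes "deriv_family U D" "open U" "x \<in> U" "\<And>y. y \<in> U \<Longrightarrow> D ds y = D ds' y"
  shows "D (h # ds) x = D (h # ds') x"
proof -
  have "(D ds' has_derivative (\<lambda>h. D (h # ds) x)) (at x)"
    using has_derivative_transform_within_open[OF deriv_familyD[OF assms(1,3)] assms(2,3)] assms(4)
    by blast
  then show ?thesis
    using has_derivative_unique[OF _ deriv_familyD[OF assms(1,3)]] by meson
qed

section \<open>Chain rule along curves and symmetry of mixed derivatives\<close>

lemma deriv_family_along_curve:
  assumes "deriv_family U D" "c t \<in> U" "(c has_vector_derivative c') (at t)"
  shows "((\<lambda>t. D ds (c t)) has_real_derivative D (c' # ds) (c t)) (at t)"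
proof -
  have "((\<lambda>t. D ds (c t)) has_derivative (\<lambda>k. D ((k *\<^sub>R c') # ds) (c t))) (at t)"
    using diff_chain_at[OF assms(3)[unfolded has_vector_derivative_def]
        deriv_familyD[OF assms(1,2), of ds]] by (simp add: o_def)
  moreover have "D ((k *\<^sub>R c') # ds) (c t) = D (c' # ds) (c t) * k" for k
    using linear_cmul[OF deriv_family_linear[OF assms(1,2), of ds]] by simp
  ultimately show ?thesis
    by (simp add: has_field_derivative_def)
qed

text \<open>The mean value theorem is applied twice: in direction \<open>a\<close> to the increment
  along \<open>h *\<^sub>R b\<close>, then in direction \<open>b\<close> to the derivative
  obtained.\<close>

lemma deriv_family_second_difference:
  assumes D: "deriv_family U D" and "0 < (h::real)"
    and U: "\<And>s t. 0 \<le> s \<Longrightarrow> s \<le> h \<Longrightarrow> 0 \<le> t \<Longrightarrow> t \<le> h \<Longrightarrow> x + s *\<^sub>R a + t *\<^sub>R b \<in> U"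
  shows "\<exists>s t. 0 < s \<and> s < h \<and> 0 < t \<and> t < h \<and>
    D ds (x + h *\<^sub>R a + h *\<^sub>R b) - D ds (x + h *\<^sub>R a) - D ds (x + h *\<^sub>R b) + D ds x
      = h * (h * D (b # a # ds) (x + s *\<^sub>R a + t *\<^sub>R b))"
proof -
  have "\<exists>s. 0 < s \<and> s < h \<and>
     (D ds (x + h *\<^sub>R a + h *\<^sub>R b) - D ds (x + h *\<^sub>R a + 0 *\<^sub>R b)) -
     (D ds (x + 0 *\<^sub>R a + h *\<^sub>R b) - D ds (x + 0 *\<^sub>R a + 0 *\<^sub>R b))
     = (h - 0) * (D (a # ds) (x + s *\<^sub>R a + h *\<^sub>R b) - D (a # ds) (x + s *\<^sub>R a + 0 *\<^sub>R b))"
    by (rule MVT2[OF \<open>0 < h\<close>, where f = "\<lambda>s. D ds (x + s *\<^sub>R a + h *\<^sub>R b) - D ds (x + s *\<^sub>R a + 0 *\<^sub>R b)"])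
       (intro DERIV_diff deriv_family_along_curve[OF D] U,
        use \<open>0 < h\<close> in \<open>auto intro!: derivative_eq_intros\<close>)
  then obtain s where s: "0 < s" "s < h"
    "D ds (x + h *\<^sub>R a + h *\<^sub>R b) - D ds (x + h *\<^sub>R a) - D ds (x + h *\<^sub>R b) + D ds x
     = h * (D (a # ds) (x + s *\<^sub>R a + h *\<^sub>R b) - D (a # ds) (x + s *\<^sub>R a + 0 *\<^sub>R b))"
    by (auto simp: algebra_simps)
  have "\<exists>t. 0 < t \<and> t < h \<and>
     D (a # ds) (x + s *\<^sub>R a + h *\<^sub>R b) - D (a # ds) (x + s *\<^sub>R a + 0 *\<^sub>R b)
     = (h - 0) * D (b # a # ds) (x + s *\<^sub>R a + t *\<^sub>R b)"
    by (rule MVT2[OF \<open>0 < h\<close>, where f = "\<lambda>t. D (a # ds) (x + s *\<^sub>R a + t *\<^sub>R b)"])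
       (intro deriv_family_along_curve[OF D] U,
        use s in \<open>auto intro!: derivative_eq_intros\<close>)
  with s show ?thesis by auto
qed

text \<open>The second difference over a small parallelogram is symmetric in \<open>a\<close> and
  \<open>b\<close>, and it equals the square of \<open>h\<close> times either mixed derivative at
  some point of the parallelogram. Continuity at \<open>x\<close> then identifies the two.\<close>

lemma deriv_family_swap:
  assumes D: "deriv_family U D" and "open U" "x \<in> U"
  shows "D (a # b # ds) x = D (b # a # ds) x"
proof (rule ccontr)
  assume neq: "D (a # b # ds) x \<noteq> D (b # a # ds) x"
  \<comment> \<open>Half the gap: values within \<open>e\<close> of two numbers that are
    \<open>2 * e\<close> apart cannot coincide.\<close>
  define e where "e = \<bar>D (a # b # ds) x - D (b # a # ds) x\<bar> / 2"
  have "e > 0" using neq by (simp add: e_def)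
  have ev: "\<forall>\<^sub>F y in nhds x. y \<in> U \<and> dist (D (a # b # ds) y) (D (a # b # ds) x) < e \<and>
      dist (D (b # a # ds) y) (D (b # a # ds) x) < e"
    using deriv_family_isCont[OF D assms(3)] \<open>e > 0\<close>
    by (intro eventually_conj eventually_nhds_in_open[OF assms(2,3)] tendstoD)
       (auto simp: isCont_def tendsto_at_iff_tendsto_nhds)
  then obtain d where "d > 0" and d: "\<And>y. dist y x < d \<Longrightarrow> y \<in> U \<and>
      dist (D (a # b # ds) y) (D (a # b # ds) x) < e \<and>
      dist (D (b # a # ds) y) (D (b # a # ds) x) < e"
    unfolding eventually_nhds_metric by blast
  \<comment> \<open>Small enough for the whole parallelogram to lie in the ball of radius
    \<open>d\<close>; the summand 1 covers \<open>a = b = 0\<close>.\<close>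
  define h where "h = d / (norm a + norm b + 1)"
  have pos: "norm a + norm b + 1 > 0" by (simp add: add_nonneg_pos)
  have "h > 0" using \<open>d > 0\<close> pos by (simp add: h_def)
  have near: "dist (x + s *\<^sub>R a + t *\<^sub>R b) x < d"
    if "0 \<le> s" "s \<le> h" "0 \<le> t" "t \<le> h" for s t
  proof -
    have "dist (x + s *\<^sub>R a + t *\<^sub>R b) x = norm (s *\<^sub>R a + t *\<^sub>R b)"
      by (simp add: dist_norm add.assoc)
    also have "\<dots> \<le> s * norm a + t * norm b"
      using that by (metis abs_of_nonneg norm_scaleR norm_triangle_ineq)
    also have "\<dots> \<le> h * norm a + h * norm b"
      using that by (intro add_mono mult_right_mono) auto
    also have "\<dots> < h * (norm a + norm b + 1)"
      using \<open>h > 0\<close> by (simp add: algebra_simps)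
    also have "\<dots> = d" using pos by (simp add: h_def)
    finally show ?thesis .
  qed
  obtain s t where st: "0 < s" "s < h" "0 < t" "t < h"
    "D ds (x + h *\<^sub>R a + h *\<^sub>R b) - D ds (x + h *\<^sub>R a) - D ds (x + h *\<^sub>R b) + D ds x
      = h * (h * D (b # a # ds) (x + s *\<^sub>R a + t *\<^sub>R b))"
    using deriv_family_second_difference[OF D \<open>h > 0\<close>, of x a b ds] near d by blast
  have near': "x + s *\<^sub>R b + t *\<^sub>R a \<in> U"
    if "0 \<le> s" "s \<le> h" "0 \<le> t" "t \<le> h" for s t
    using d[OF near[OF that(3,4,1,2)]] by (simp add: add.commute add.left_commute)
  obtain s' t' where st': "0 < s'" "s' < h" "0 < t'" "t' < h"
    "D ds (x + h *\<^sub>R b + h *\<^sub>R a) - D ds (x + h *\<^sub>R b) - D ds (x + h *\<^sub>R a) + D ds x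
      = h * (h * D (a # b # ds) (x + s' *\<^sub>R b + t' *\<^sub>R a))"
    using deriv_family_second_difference[OF D \<open>h > 0\<close>, of x b a ds] near' by blast
  have "D ds (x + h *\<^sub>R b + h *\<^sub>R a) = D ds (x + h *\<^sub>R a + h *\<^sub>R b)"
    by (simp add: add.commute add.left_commute)
  then have "h * (h * D (b # a # ds) (x + s *\<^sub>R a + t *\<^sub>R b))
      = h * (h * D (a # b # ds) (x + s' *\<^sub>R b + t' *\<^sub>R a))"
    using st(5) st'(5) by linarith
  then have "D (b # a # ds) (x + s *\<^sub>R a + t *\<^sub>R b) = D (a # b # ds) (x + s' *\<^sub>R b + t' *\<^sub>R a)"
    using \<open>h > 0\<close> by simp
  moreover have "dist (D (b # a # ds) (x + s *\<^sub>R a + t *\<^sub>R b)) (D (b # a # ds) x) < e"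
    using d[OF near[of s t]] st by simp
  moreover have "dist (D (a # b # ds) (x + s' *\<^sub>R b + t' *\<^sub>R a)) (D (a # b # ds) x) < e"
    using d[OF near[of t' s']] st' by (simp add: add.commute add.left_commute)
  ultimately show False
    unfolding e_def dist_real_def by argo
qed

lemma deriv_family_linear2:
  assumes D: "deriv_family U D" and "open U" "x \<in> U"
  shows "linear (\<lambda>h. D (a # h # ds) x)"
  using deriv_family_linear[OF D assms(3), of "a # ds"] deriv_family_swap[OF assms] by simp

lemma deriv_family_expand:
  assumes D: "deriv_family U D" "x \<in> U"
  shows "D (X # ds) x = (\<Sum>b\<in>Basis. (X \<bullet> b) * D (b # ds) x)"
proof -
  have "D (X # ds) x = D ((\<Sum>b\<in>Basis. (X \<bullet> b) *\<^sub>R b) # ds) x"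
    by (simp add: euclidean_representation)
  also have "\<dots> = (\<Sum>b\<in>Basis. (X \<bullet> b) * D (b # ds) x)"
    by (subst linear_sum[OF deriv_family_linear[OF D]])
       (simp add: linear_cmul[OF deriv_family_linear[OF D]])
  finally show ?thesis .
qed

text \<open>The direction moves with \<open>t\<close>, so \<open>X t\<close> is expanded in the
  fixed basis and the product rule is applied to each summand. Symmetry of mixed derivatives allows
  the sum to be reassembled in the second slot.\<close>

lemma deriv_family_field_along_curve:
  assumes D: "deriv_family U D" and "open U" and U: "c t \<in> U"
    and c: "(c has_vector_derivative c') (at t)" and X: "(X has_vector_derivative X') (at t)"
  shows "((\<lambda>t. D [X t] (c t)) has_real_derivative D [X'] (c t) + D [c', X t] (c t)) (at t)"
proof -
  have 1: "((\<lambda>t. X t \<bullet> b) has_real_derivative X' \<bullet> b) (at t)" for b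
    using bounded_linear.has_vector_derivative[OF bounded_linear_inner_left X]
    by (simp add: has_real_derivative_iff_has_vector_derivative)
  have "((\<lambda>t. \<Sum>b\<in>Basis. (X t \<bullet> b) * D [b] (c t)) has_real_derivative
      (\<Sum>b\<in>Basis. (X' \<bullet> b) * D [b] (c t) + D [c', b] (c t) * (X t \<bullet> b))) (at t)"
    by (intro DERIV_sum DERIV_mult 1 deriv_family_along_curve[OF D U c])
  moreover have "(\<Sum>b\<in>Basis. (X' \<bullet> b) * D [b] (c t) + D [c', b] (c t) * (X t \<bullet> b))
     = D [X'] (c t) + D [c', X t] (c t)"
    using deriv_family_expand[OF D U, of X' "[]"] deriv_family_expand[OF D U, of "X t" "[c']"]
      deriv_family_swap[OF D \<open>open U\<close> U, of c' _ "[]"]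
    by (simp add: sum.distrib mult.commute)
  moreover have "\<forall>\<^sub>F s in nhds t. c s \<in> U"
    using has_vector_derivative_continuous[OF c] \<open>open U\<close> U
    by (auto simp: isCont_def tendsto_at_iff_tendsto_nhds dest: topological_tendstoD)
  then have "\<forall>\<^sub>F s in nhds t. D [X s] (c s) = (\<Sum>b\<in>Basis. (X s \<bullet> b) * D [b] (c s))"
    by (rule eventually_mono) (rule deriv_family_expand[OF D])
  ultimately show ?thesis
    by (simp add: DERIV_cong_ev)
qed

text \<open>Brings mixed partials into the normal order with all \<open>e\<close> in front of all
  \<open>f\<close>. A transposition below further derivatives is carried through by
  \<open>deriv_family_cong\<close>.\<close>

lemma deriv_family_swap_replicate:
  assumes E: "deriv_family W E" "open W" and "y \<in> W"
  shows "E (f # replicate i e @ ds) y = E (replicate i e @ f # ds) y"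
  using \<open>y \<in> W\<close>
proof (induction i arbitrary: y)
  case (Suc i)
  have "E (f # e # replicate i e @ ds) y = E (e # f # replicate i e @ ds) y"
    by (rule deriv_family_swap[OF E Suc.prems])
  also have "\<dots> = E (e # replicate i e @ f # ds) y"
    by (rule deriv_family_cong[OF E Suc.prems Suc.IH])
  finally show ?case by simp
qed simp

text \<open>Evaluates a derivative from a formula \<open>F\<close> for the preceding one:
  differentiating \<open>F\<close> along a straight line is enough.\<close>

lemma deriv_family_line:
  assumes E: "deriv_family W E" and "open W" "y \<in> W" and F: "\<And>z. z \<in> W \<Longrightarrow> E ds z = F z"
    and V: "((\<lambda>\<tau>. F (y + \<tau> *\<^sub>R a)) has_real_derivative V) (at 0)"
  shows "E (a # ds) y = V"
proof -
  have line: "((\<lambda>\<tau>. y + \<tau> *\<^sub>R a) has_vector_derivative a) (at t)" for t :: real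
    by (auto intro!: derivative_eq_intros)
  have "((\<lambda>\<tau>. E ds (y + \<tau> *\<^sub>R a)) has_real_derivative E (a # ds) y) (at 0)"
    using deriv_family_along_curve[OF E _ line, of 0 ds] \<open>y \<in> W\<close> by simp
  moreover have "open ((\<lambda>\<tau>::real. y + \<tau> *\<^sub>R a) -` W)"
    by (intro open_vimage \<open>open W\<close> continuous_intros)
  ultimately have "((\<lambda>\<tau>. F (y + \<tau> *\<^sub>R a)) has_real_derivative E (a # ds) y) (at 0)"
    by (rule has_field_derivative_transform_within_open) (use \<open>y \<in> W\<close> F in auto)
  then show ?thesis using V by (rule DERIV_unique)
qed

section \<open>Smoothness of powers and of pullbacks to the chart\<close>

lemma smooth_on_iff_deriv_family:
  "smooth_on U f \<longleftrightarrow> (\<exists>D. deriv_family U D \<and> (\<forall>x\<in>U. D [] x = f x))"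
  by (auto simp: smooth_on_def deriv_family_def)

text \<open>Choosing for every member of \<open>S\<close> partial derivatives inside
  \<open>S\<close>, and iterating the choice, yields all higher derivatives at once.\<close>

lemma deriv_family_of_closed_set:
  assumes "f \<in> S"
    and S: "\<And>g. g \<in> S \<Longrightarrow> \<exists>g'. (\<forall>h. g' h \<in> S) \<and> (\<forall>x\<in>U. (g has_derivative (\<lambda>h. g' h x)) (at x))"
  shows "\<exists>D. deriv_family U D \<and> D [] = f"
proof -
  obtain \<delta> where \<delta>: "\<And>g h. g \<in> S \<Longrightarrow> \<delta> g h \<in> S"
      "\<And>g x. g \<in> S \<Longrightarrow> x \<in> U \<Longrightarrow> (g has_derivative (\<lambda>h. \<delta> g h x)) (at x)"
    using S by metis
  \<comment> \<open>\<open>foldr\<close> lets the head of the list act last, in agreement with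
    \<open>deriv_family\<close>.\<close>
  define D where "D ds = foldr (\<lambda>h g. \<delta> g h) ds f" for ds
  have "D ds \<in> S" for ds
    by (induction ds) (use \<open>f \<in> S\<close> \<delta>(1) in \<open>auto simp: D_def\<close>)
  then have "deriv_family U D"
    using \<delta>(2) by (auto simp: deriv_family_def) (simp add: D_def)
  then show ?thesis by (auto simp: D_def)
qed

text \<open>
  An algebra of functions whose generators have partial derivatives inside the algebra consists of
  smooth functions; this replaces Leibniz and Faa di Bruno formulas for iterated derivatives.
\<close>

inductive_set fun_alg :: "(real^3 \<Rightarrow> real) set \<Rightarrow> (real^3 \<Rightarrow> real) set" for B where
  base: "f \<in> B \<Longrightarrow> f \<in> fun_alg B"
| const: "(\<lambda>_. c) \<in> fun_alg B"
| add: "f \<in> fun_alg B \<Longrightarrow> g \<in> fun_alg B \<Longrightarrow> (\<lambda>x. f x + g x) \<in> fun_alg B"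
| mult: "f \<in> fun_alg B \<Longrightarrow> g \<in> fun_alg B \<Longrightarrow> (\<lambda>x. f x * g x) \<in> fun_alg B"

lemma deriv_family_of_fun_alg:
  assumes "f \<in> fun_alg B"
    and B: "\<And>b. b \<in> B \<Longrightarrow> \<exists>b'. (\<forall>h. b' h \<in> fun_alg B) \<and> (\<forall>x\<in>U. (b has_derivative (\<lambda>h. b' h x)) (at x))"
  shows "\<exists>D. deriv_family U D \<and> D [] = f"
proof (rule deriv_family_of_closed_set[OF assms(1)])
  fix g assume "g \<in> fun_alg B"
  then show "\<exists>g'. (\<forall>h. g' h \<in> fun_alg B) \<and> (\<forall>x\<in>U. (g has_derivative (\<lambda>h. g' h x)) (at x))"
  proof induction
    case (base f)
    then show ?case by (rule B)
  next
    case (const c)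
    show ?case by (rule exI[of _ "\<lambda>h x. 0"]) (auto intro: fun_alg.const)
  next
    case (add f g)
    then obtain f' g' where *: "\<And>h. f' h \<in> fun_alg B" "\<And>h. g' h \<in> fun_alg B"
      "\<And>x. x \<in> U \<Longrightarrow> (f has_derivative (\<lambda>h. f' h x)) (at x)"
      "\<And>x. x \<in> U \<Longrightarrow> (g has_derivative (\<lambda>h. g' h x)) (at x)" by metis
    show ?case
      by (rule exI[of _ "\<lambda>h x. f' h x + g' h x"])
         (use * in \<open>auto intro!: fun_alg.add has_derivative_add\<close>)
  next
    case (mult f g)
    then obtain f' g' where *: "\<And>h. f' h \<in> fun_alg B" "\<And>h. g' h \<in> fun_alg B"
      "\<And>x. x \<in> U \<Longrightarrow> (f has_derivative (\<lambda>h. f' h x)) (at x)"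
      "\<And>x. x \<in> U \<Longrightarrow> (g has_derivative (\<lambda>h. g' h x)) (at x)" by metis
    show ?case
      by (rule exI[of _ "\<lambda>h x. f x * g' h x + f' h x * g x"])
         (use * mult.hyps in \<open>auto intro!: fun_alg.add fun_alg.mult has_derivative_mult\<close>)
  qed
qed

text \<open>All real exponents enter the generators, since differentiating a power lowers its
  exponent by 1; positivity keeps every power differentiable.\<close>

lemma deriv_family_powr:
  assumes D: "deriv_family U D" and pos: "\<And>x. x \<in> U \<Longrightarrow> D [] x > 0"
  shows "\<exists>E. deriv_family U E \<and> E [] = (\<lambda>x. D [] x powr a)"
proof -
  define B where "B = range D \<union> range (\<lambda>a x. D [] x powr a)"
  have D_in: "D ds \<in> fun_alg B" and powr_in: "(\<lambda>x. D [] x powr a) \<in> fun_alg B" for ds a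
    by (auto intro!: fun_alg.base simp: B_def)
  show ?thesis
  proof (rule deriv_family_of_fun_alg[OF powr_in])
    fix b assume "b \<in> B"
    then consider ds where "b = D ds" | a where "b = (\<lambda>x. D [] x powr a)"
      by (auto simp: B_def)
    then show "\<exists>b'. (\<forall>h. b' h \<in> fun_alg B) \<and> (\<forall>x\<in>U. (b has_derivative (\<lambda>h. b' h x)) (at x))"
    proof cases
      case 1
      then show ?thesis
        using D_in deriv_familyD[OF D] by (intro exI[of _ "\<lambda>h. D (h # ds)"]) auto
    next
      case 2
      have "(b has_derivative (\<lambda>h. a * (D [] x powr (a - 1) * D [h] x))) (at x)" if "x \<in> U" for x
        unfolding 2
        by (rule has_derivative_eq_rhs[OF has_derivative_powr[OF deriv_familyD[OF D that] has_derivative_const pos[OF that]]])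
           (use pos[OF that] in \<open>auto simp: powr_diff fun_eq_iff\<close>)
      then show ?thesis
        using D_in powr_in
        by (intro exI[of _ "\<lambda>h x. a * (D [] x powr (a - 1) * D [h] x)"])
           (auto intro!: fun_alg.mult fun_alg.const)
    qed
  qed
qed

text \<open>
  Longitude \<open>y \<bullet> e\<close> and latitude \<open>y \<bullet> f\<close> about the point \<open>q\<close>. The domain is \<open>real^3\<close> rather than
  the plane, with a redundant third coordinate, so that \<open>deriv_family\<close> applies to pullbacks.
\<close>

definition geo_chart :: "real^3 \<Rightarrow> real^3 \<Rightarrow> real^3 \<Rightarrow> real^3 \<Rightarrow> real^3" where
  "geo_chart q e f y = (cos (y \<bullet> f) * cos (y \<bullet> e)) *\<^sub>R q + (cos (y \<bullet> f) * sin (y \<bullet> e)) *\<^sub>R e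
     + sin (y \<bullet> f) *\<^sub>R f"

lemma has_derivative_geo_chart:
  "(geo_chart q e f has_derivative (\<lambda>h.
     (- (h \<bullet> f) * (sin (y \<bullet> f) * cos (y \<bullet> e)) + - (h \<bullet> e) * (cos (y \<bullet> f) * sin (y \<bullet> e))) *\<^sub>R q
   + (- (h \<bullet> f) * (sin (y \<bullet> f) * sin (y \<bullet> e)) + (h \<bullet> e) * (cos (y \<bullet> f) * cos (y \<bullet> e))) *\<^sub>R e
   + ((h \<bullet> f) * cos (y \<bullet> f)) *\<^sub>R f)) (at y)"
  unfolding geo_chart_def
  by (auto intro!: derivative_eq_intros simp: fun_eq_iff algebra_simps)

text \<open>The derivative of the chart is a combination of the fixed vectors \<open>q\<close>,
  \<open>e\<close>, \<open>f\<close> with trigonometric coefficients. By linearity in the head,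
  differentiating a pulled-back \<open>D ds\<close> therefore stays in the algebra generated by
  these functions and four sines and cosines.\<close>

lemma deriv_family_geo_chart:
  assumes D: "deriv_family U D"
  shows "\<exists>E. deriv_family (geo_chart q e f -` U) E \<and> E [] = (\<lambda>y. D [] (geo_chart q e f y))"
proof -
  let ?\<Xi> = "geo_chart q e f"
  define B where "B = range (\<lambda>ds y. D ds (?\<Xi> y)) \<union>
     {\<lambda>y. sin (y \<bullet> e), \<lambda>y. cos (y \<bullet> e), \<lambda>y. sin (y \<bullet> f), \<lambda>y. cos (y \<bullet> f)}"
  have D_in: "(\<lambda>y. D ds (?\<Xi> y)) \<in> fun_alg B" for ds
    by (auto intro!: fun_alg.base simp: B_def)
  have trig_in: "(\<lambda>y. sin (y \<bullet> e)) \<in> fun_alg B" "(\<lambda>y. cos (y \<bullet> e)) \<in> fun_alg B"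
    "(\<lambda>y. sin (y \<bullet> f)) \<in> fun_alg B" "(\<lambda>y. cos (y \<bullet> f)) \<in> fun_alg B"
    by (auto intro!: fun_alg.base simp: B_def)
  show ?thesis
  proof (rule deriv_family_of_fun_alg[OF D_in])
    fix b assume "b \<in> B"
    then consider ds where "b = (\<lambda>y. D ds (?\<Xi> y))"
      | a where "b = (\<lambda>y. sin (y \<bullet> a))" "a = e \<or> a = f"
      | a where "b = (\<lambda>y. cos (y \<bullet> a))" "a = e \<or> a = f"
      by (auto simp: B_def)
    then show "\<exists>b'. (\<forall>h. b' h \<in> fun_alg B) \<and> (\<forall>x\<in>?\<Xi> -` U. (b has_derivative (\<lambda>h. b' h x)) (at x))"
    proof cases
      case 1
      let ?b' = "\<lambda>h y.
         (- (h \<bullet> f) * (sin (y \<bullet> f) * cos (y \<bullet> e)) + - (h \<bullet> e) * (cos (y \<bullet> f) * sin (y \<bullet> e))) * D (q # ds) (?\<Xi> y)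
       + (- (h \<bullet> f) * (sin (y \<bullet> f) * sin (y \<bullet> e)) + (h \<bullet> e) * (cos (y \<bullet> f) * cos (y \<bullet> e))) * D (e # ds) (?\<Xi> y)
       + ((h \<bullet> f) * cos (y \<bullet> f)) * D (f # ds) (?\<Xi> y)"
      have "(b has_derivative (\<lambda>h. ?b' h y)) (at y)" if "?\<Xi> y \<in> U" for y
      proof -
        note lin = deriv_family_linear[OF D that, of ds]
        show ?thesis
          unfolding 1
          by (rule has_derivative_eq_rhs[OF diff_chain_at[OF has_derivative_geo_chart deriv_familyD[OF D that], unfolded o_def]])
             (simp only: fun_eq_iff linear_add[OF lin] linear_cmul[OF lin] real_scaleR_def simp_thms)
      qed
      moreover have "?b' h \<in> fun_alg B" for h
        by (intro fun_alg.add fun_alg.mult trig_in D_in fun_alg.const)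
      ultimately show ?thesis by (intro exI[of _ ?b']) auto
    next
      case 2
      have "(b has_derivative (\<lambda>h. (h \<bullet> a) * cos (y \<bullet> a))) (at y)" for y
        unfolding 2 by (auto intro!: derivative_eq_intros simp: fun_eq_iff)
      moreover have "(\<lambda>y. (h \<bullet> a) * cos (y \<bullet> a)) \<in> fun_alg B" for h
        using 2 trig_in by (intro fun_alg.mult fun_alg.const) auto
      ultimately show ?thesis by (intro exI[of _ "\<lambda>h y. (h \<bullet> a) * cos (y \<bullet> a)"]) auto
    next
      case 3
      have "(b has_derivative (\<lambda>h. - (h \<bullet> a) * sin (y \<bullet> a))) (at y)" for y
        unfolding 3 by (auto intro!: derivative_eq_intros simp: fun_eq_iff)
      moreover have "(\<lambda>y. - (h \<bullet> a) * sin (y \<bullet> a)) \<in> fun_alg B" for h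
        using 3 trig_in by (intro fun_alg.mult fun_alg.const) auto
      ultimately show ?thesis by (intro exI[of _ "\<lambda>h y. - (h \<bullet> a) * sin (y \<bullet> a)"]) auto
    qed
  qed
qed

section \<open>The degenerate jet\<close>

text \<open>If \<open>g2\<close> were negative, \<open>g1\<close> would be negative just to the
  right of its zero at 0, and the mean value theorem would make \<open>g\<close> negative
  there.\<close>

lemma local_min_second_derivative:
  fixes g g1 :: "real \<Rightarrow> real"
  assumes "0 < \<delta>" and g: "\<And>t. \<bar>t\<bar> < \<delta> \<Longrightarrow> (g has_real_derivative g1 t) (at t)"
    and g1: "(g1 has_real_derivative g2) (at 0)"
    and nonneg: "\<And>t. \<bar>t\<bar> < \<delta> \<Longrightarrow> 0 \<le> g t" and zero: "g 0 = 0"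
  shows "g1 0 = 0" "0 \<le> g2"
proof -
  show 1: "g1 0 = 0"
    using DERIV_local_min[OF g \<open>0 < \<delta>\<close>] assms(1) nonneg zero by simp
  show "0 \<le> g2"
  proof (rule ccontr)
    assume "\<not> 0 \<le> g2"
    then obtain \<epsilon> where \<epsilon>: "\<epsilon> > 0" "\<And>h. h > 0 \<Longrightarrow> h < \<epsilon> \<Longrightarrow> g1 (0 + h) < g1 0"
      using DERIV_neg_dec_right[OF g1] by auto
    define t where "t = min \<epsilon> \<delta> / 2"
    have t: "0 < t" "t < \<epsilon>" "t < \<delta>" using \<epsilon>(1) \<open>0 < \<delta>\<close> by (auto simp: t_def min_def)
    obtain z where "0 < z" "z < t" "g t - g 0 = (t - 0) * g1 z"
      using MVT2[of 0 t g g1] g t by auto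
    moreover from this have "g1 z < 0" using \<epsilon>(2)[of z] t 1 by simp
    ultimately have "g t < 0" using zero t by (simp add: mult_pos_neg)
    then show False using nonneg[of t] t by simp
  qed
qed

text \<open>Both \<open>g\<close> and its negative have a minimum at 0.\<close>

lemma zero_function_second_derivative:
  fixes g g1 :: "real \<Rightarrow> real"
  assumes "0 < \<delta>" and "\<And>t. \<bar>t\<bar> < \<delta> \<Longrightarrow> (g has_real_derivative g1 t) (at t)"
    and "(g1 has_real_derivative g2) (at 0)" and "\<And>t. \<bar>t\<bar> < \<delta> \<Longrightarrow> g t = 0"
  shows "g1 0 = 0" "g2 = 0"
proof -
  show "g1 0 = 0"
    using local_min_second_derivative[of \<delta> g g1 g2] assms by simp
  have "((\<lambda>t. - g t) has_real_derivative - g1 t) (at t)" if "\<bar>t\<bar> < \<delta>" for t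
    using assms(2)[OF that] by (rule DERIV_minus)
  moreover have "((\<lambda>t. - g1 t) has_real_derivative - g2) (at 0)"
    using assms(3) by (rule DERIV_minus)
  ultimately have "0 \<le> - g2"
    using local_min_second_derivative[of \<delta> "\<lambda>t. - g t" "\<lambda>t. - g1 t" "- g2"] assms by simp
  moreover have "0 \<le> g2"
    using local_min_second_derivative[of \<delta> g g1 g2] assms by simp
  ultimately show "g2 = 0" by simp
qed

text \<open>
  Here \<open>A, a, b, G, T, Q\<close> stand for \<open>v, v\<^sub>s, v\<^sub>t, v\<^sub>s\<^sub>s, v\<^sub>s\<^sub>s\<^sub>t, v\<^sub>s\<^sub>s\<^sub>t\<^sub>t + v\<^sub>t\<^sub>t\<^sub>t\<^sub>t\<close> at the degenerate point.
\<close>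

lemma degenerate_jet_contradiction:
  fixes A G a b T Q c d :: real
  assumes "A > 0"
    and e0: "A * G + c * (b\<^sup>2 + a\<^sup>2) + d = 0"
    and e1: "b * G + A * (T - b) = 0"
    and e2: "2 * b * (T - b) + A * Q - 2 * c * b\<^sup>2 - 2 * d = 0"
    and ineq: "0 \<le> Q * G - 2 * T\<^sup>2 - 2 * a\<^sup>2"
    and cd: "(0 \<le> c \<and> 0 < d) \<or> (c \<le> -2 \<and> d < 0)"
  shows False
proof -
  \<comment> \<open>\<open>e2\<close> eliminates \<open>Q\<close> and \<open>e1\<close> eliminates
    \<open>T\<close>; the terms in \<open>b * G * T\<close> cancel.\<close>
  have "A * (Q * G - 2 * T\<^sup>2 - 2 * a\<^sup>2) = 2 * (G * ((c + 2) * b\<^sup>2 + d)) - 2 * A * (a\<^sup>2 + b\<^sup>2)"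
    using e1 e2 by algebra
  \<comment> \<open>By \<open>e0\<close> the sign of \<open>G\<close> is opposite to that of
    \<open>d\<close>, whereas \<open>(c + 2) * b\<^sup>2 + d\<close> has the sign of
    \<open>d\<close>.\<close>
  moreover have "G * ((c + 2) * b\<^sup>2 + d) < 0"
    using cd
  proof
    assume *: "0 \<le> c \<and> 0 < d"
    then have "A * G < 0" using e0 by (smt (verit) mult_nonneg_nonneg sum_power2_ge_zero)
    then have "G < 0" using \<open>A > 0\<close> by (simp add: mult_less_0_iff)
    moreover have "(c + 2) * b\<^sup>2 + d > 0" using * by (simp add: add_nonneg_pos)
    ultimately show ?thesis by (rule mult_neg_pos)
  next
    assume *: "c \<le> -2 \<and> d < 0"
    then have "A * G > 0" using e0 by (smt (verit) mult_nonpos_nonneg sum_power2_ge_zero)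
    then have "G > 0" using \<open>A > 0\<close> by (simp add: zero_less_mult_iff)
    moreover have "(c + 2) * b\<^sup>2 + d < 0" using * by (smt (verit) mult_nonpos_nonneg zero_le_power2)
    ultimately show ?thesis by (rule mult_pos_neg)
  qed
  moreover have "0 \<le> A * (a\<^sup>2 + b\<^sup>2)" "0 \<le> A * (Q * G - 2 * T\<^sup>2 - 2 * a\<^sup>2)"
    using \<open>A > 0\<close> ineq by simp_all
  ultimately show False by linarith
qed

text \<open>
  \<open>p i j\<close> and \<open>q i j\<close> are the restrictions of \<open>\<partial>\<^sub>s\<^sup>i \<partial>\<^sub>t\<^sup>j v\<close> to the axes \<open>t = 0\<close> and \<open>s = 0\<close>, for the metric
  \<open>cos\<^sup>2 t ds\<^sup>2 + dt\<^sup>2\<close>. The determinant and the equation are multiplied by \<open>cos\<^sup>2 t\<close> to clear denominators.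
\<close>

lemma degenerate_hessian_contradiction:
  fixes p q :: "nat \<Rightarrow> nat \<Rightarrow> real \<Rightarrow> real" and c d \<delta> :: real
  assumes \<delta>: "0 < \<delta>"
    and p': "\<And>i j s. \<bar>s\<bar> < \<delta> \<Longrightarrow> (p i j has_real_derivative p (Suc i) j s) (at s)"
    and q': "\<And>i j t. \<bar>t\<bar> < \<delta> \<Longrightarrow> (q i j has_real_derivative q i (Suc j) t) (at t)"
    and pq: "\<And>i j. p i j 0 = q i j 0"
    and pos: "q 0 0 0 > 0"
    and detp: "\<And>s. \<bar>s\<bar> < \<delta> \<Longrightarrow> 0 \<le> p 0 2 s * p 2 0 s - (p 1 1 s)\<^sup>2"
    and detq: "\<And>t. \<bar>t\<bar> < \<delta> \<Longrightarrow> 0 \<le> (cos t)\<^sup>2 * q 0 2 t * (q 2 0 t - sin t * cos t * q 0 1 t)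
        - (cos t * q 1 1 t + sin t * q 1 0 t)\<^sup>2"
    and pde: "\<And>t. \<bar>t\<bar> < \<delta> \<Longrightarrow> q 0 0 t * ((cos t)\<^sup>2 * q 0 2 t + (q 2 0 t - sin t * cos t * q 0 1 t))
        + c * ((cos t)\<^sup>2 * (q 0 1 t)\<^sup>2 + (q 1 0 t)\<^sup>2) + d * (cos t)\<^sup>2 = 0"
    and deg: "q 0 2 0 = 0" "q 1 1 0 = 0"
    and cd: "(0 \<le> c \<and> 0 < d) \<or> (c \<le> -2 \<and> d < 0)"
  shows False
proof -
  have dp: "(p 0 2 has_real_derivative p 1 2 s) (at s)" "(p 1 2 has_real_derivative p 2 2 s) (at s)"
    "(p 2 0 has_real_derivative p 3 0 s) (at s)" "(p 3 0 has_real_derivative p 4 0 s) (at s)"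
    "(p 1 1 has_real_derivative p 2 1 s) (at s)" "(p 2 1 has_real_derivative p 3 1 s) (at s)"
    if "\<bar>s\<bar> < \<delta>" for s
    using p'[OF that, of 0 2] p'[OF that, of 1 2] p'[OF that, of 2 0] p'[OF that, of 3 0]
      p'[OF that, of 1 1] p'[OF that, of 2 1] by (simp_all add: eval_nat_numeral)
  have dq: "(q 0 0 has_real_derivative q 0 1 t) (at t)" "(q 0 1 has_real_derivative q 0 2 t) (at t)"
    "(q 0 2 has_real_derivative q 0 3 t) (at t)" "(q 0 3 has_real_derivative q 0 4 t) (at t)"
    "(q 2 0 has_real_derivative q 2 1 t) (at t)" "(q 2 1 has_real_derivative q 2 2 t) (at t)"
    "(q 1 0 has_real_derivative q 1 1 t) (at t)" "(q 1 1 has_real_derivative q 1 2 t) (at t)"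
    "(q 1 2 has_real_derivative q 1 3 t) (at t)"
    if "\<bar>t\<bar> < \<delta>" for t
    using q'[OF that, of 0 0] q'[OF that, of 0 1] q'[OF that, of 0 2] q'[OF that, of 0 3]
      q'[OF that, of 2 0] q'[OF that, of 2 1] q'[OF that, of 1 0] q'[OF that, of 1 1] q'[OF that, of 1 2]
    by (simp_all add: eval_nat_numeral)
  \<comment> \<open>On the axis \<open>s = 0\<close>, \<open>K\<close> is the \<open>ss\<close>
    component of the covariant Hessian and \<open>M\<close> below is \<open>cos t\<close> times its
    \<open>st\<close> component. The first-order terms come from the Christoffel symbols of the
    metric.\<close>
  define K where "K t = q 2 0 t - sin t * cos t * q 0 1 t" for t
  define K1 where "K1 t = q 2 1 t - ((cos t)\<^sup>2 - (sin t)\<^sup>2) * q 0 1 t - sin t * cos t * q 0 2 t" for t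
  define M where "M t = cos t * q 1 1 t + sin t * q 1 0 t" for t
  define M1 where "M1 t = cos t * q 1 2 t + cos t * q 1 0 t" for t
  have dK: "(K has_real_derivative K1 t) (at t)" if "\<bar>t\<bar> < \<delta>" for t
    unfolding K_def[abs_def] K1_def
    by (rule derivative_eq_intros dq[OF that] refl)+ (simp add: algebra_simps power2_eq_square)
  have dM: "(M has_real_derivative M1 t) (at t)" if "\<bar>t\<bar> < \<delta>" for t
    unfolding M_def[abs_def] M1_def
    by (rule derivative_eq_intros dq[OF that] refl)+ (simp add: algebra_simps power2_eq_square)
  have at0: "\<bar>0\<bar> < \<delta>" using \<delta> by simp
  have dK1: "(K1 has_real_derivative q 2 2 0 - 2 * q 0 2 0) (at 0)"
    unfolding K1_def[abs_def]
    by (rule derivative_eq_intros dq[OF at0] refl)+ (simp add: algebra_simps power2_eq_square)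
  have dM1: "(M1 has_real_derivative q 1 3 0 + q 1 1 0) (at 0)"
    unfolding M1_def[abs_def]
    by (rule derivative_eq_intros dq[OF at0] refl)+ (simp add: algebra_simps power2_eq_square)
  have K0: "K 0 = q 2 0 0" "K1 0 = q 2 1 0 - q 0 1 0" "M 0 = 0" "M1 0 = q 1 2 0 + q 1 0 0"
    using deg by (simp_all add: K_def K1_def M_def M1_def)

  \<comment> \<open>The axis \<open>t = 0\<close> is the equator, where all Christoffel symbols
    vanish; hence only bare partials occur.\<close>
  have P1: "((\<lambda>s. p 0 2 s * p 2 0 s - (p 1 1 s)\<^sup>2) has_real_derivative
      p 1 2 s * p 2 0 s + p 0 2 s * p 3 0 s - 2 * p 1 1 s * p 2 1 s) (at s)" if "\<bar>s\<bar> < \<delta>" for s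
    by (rule derivative_eq_intros dp[OF that] refl)+ (simp add: algebra_simps power2_eq_square)
  have P2: "((\<lambda>s. p 1 2 s * p 2 0 s + p 0 2 s * p 3 0 s - 2 * p 1 1 s * p 2 1 s) has_real_derivative
      p 2 2 0 * p 2 0 0 + 2 * p 1 2 0 * p 3 0 0 + p 0 2 0 * p 4 0 0 - 2 * (p 2 1 0)\<^sup>2 - 2 * p 1 1 0 * p 3 1 0) (at 0)"
    by (rule derivative_eq_intros dp[OF at0] refl)+ (simp add: algebra_simps power2_eq_square)
  have "p 0 2 0 * p 2 0 0 - (p 1 1 0)\<^sup>2 = 0" using deg pq by simp
  \<comment> \<open>The determinant is nonnegative and vanishes at the degenerate point, so both
    minimum conditions hold. The next block repeats this along the meridian
    \<open>s = 0\<close>.\<close>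
  note minP = local_min_second_derivative[OF \<delta> P1 P2 detp this]

  have Q1: "((\<lambda>t. (cos t)\<^sup>2 * q 0 2 t * K t - (M t)\<^sup>2) has_real_derivative
      - 2 * cos t * sin t * q 0 2 t * K t + (cos t)\<^sup>2 * q 0 3 t * K t + (cos t)\<^sup>2 * q 0 2 t * K1 t
      - 2 * M t * M1 t) (at t)" if "\<bar>t\<bar> < \<delta>" for t
    by (rule derivative_eq_intros dq[OF that] dK[OF that] dM[OF that] refl)+
       (simp add: algebra_simps power2_eq_square)
  have Q2: "((\<lambda>t. - 2 * cos t * sin t * q 0 2 t * K t + (cos t)\<^sup>2 * q 0 3 t * K t
      + (cos t)\<^sup>2 * q 0 2 t * K1 t - 2 * M t * M1 t) has_real_derivative
      q 0 4 0 * K 0 + 2 * q 0 3 0 * K1 0 - 2 * (M1 0)\<^sup>2) (at 0)"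
    by (rule derivative_eq_intros dq[OF at0] dK[OF at0] dM[OF at0] dK1 dM1 refl)+
       (simp add: algebra_simps power2_eq_square deg K0)
  have "(cos 0)\<^sup>2 * q 0 2 0 * K 0 - (M 0)\<^sup>2 = 0" using deg K0 by simp
  note minQ = local_min_second_derivative[OF \<delta> Q1 Q2 detq[folded K_def M_def] this]

  \<comment> \<open>\<open>L\<close> is the Laplacian of \<open>v\<close> on the meridian,
    multiplied by the square of \<open>cos t\<close>.\<close>
  define L where "L t = (cos t)\<^sup>2 * q 0 2 t + K t" for t
  define L1 where "L1 t = - 2 * cos t * sin t * q 0 2 t + (cos t)\<^sup>2 * q 0 3 t + K1 t" for t
  have dL: "(L has_real_derivative L1 t) (at t)" if "\<bar>t\<bar> < \<delta>" for t
    unfolding L_def[abs_def] L1_def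
    by (rule derivative_eq_intros dq[OF that] dK[OF that] refl)+
       (simp add: algebra_simps power2_eq_square)
  have dL1: "(L1 has_real_derivative q 0 4 0 + q 2 2 0) (at 0)"
    unfolding L1_def[abs_def]
    by (rule derivative_eq_intros dq[OF at0] dK1 refl)+
       (simp add: algebra_simps power2_eq_square deg)
  have L0: "L 0 = q 2 0 0" "L1 0 = q 0 3 0 + q 2 1 0 - q 0 1 0"
    using deg K0 by (simp_all add: L_def L1_def)
  have E1: "((\<lambda>t. q 0 0 t * L t + c * ((cos t)\<^sup>2 * (q 0 1 t)\<^sup>2 + (q 1 0 t)\<^sup>2) + d * (cos t)\<^sup>2) has_real_derivative
      q 0 1 t * L t + q 0 0 t * L1 t + c * (- 2 * cos t * sin t * (q 0 1 t)\<^sup>2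
        + 2 * (cos t)\<^sup>2 * q 0 1 t * q 0 2 t + 2 * q 1 0 t * q 1 1 t) - 2 * d * cos t * sin t) (at t)"
    if "\<bar>t\<bar> < \<delta>" for t
    by (rule derivative_eq_intros dq[OF that] dL[OF that] refl)+
       (simp add: algebra_simps power2_eq_square)
  have E2: "((\<lambda>t. q 0 1 t * L t + q 0 0 t * L1 t + c * (- 2 * cos t * sin t * (q 0 1 t)\<^sup>2
        + 2 * (cos t)\<^sup>2 * q 0 1 t * q 0 2 t + 2 * q 1 0 t * q 1 1 t) - 2 * d * cos t * sin t) has_real_derivative
      2 * q 0 1 0 * L1 0 + q 0 0 0 * (q 0 4 0 + q 2 2 0)
      + c * (- 2 * (q 0 1 0)\<^sup>2 + 2 * q 0 1 0 * q 0 3 0 + 2 * q 1 0 0 * q 1 2 0) - 2 * d) (at 0)"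
    by (rule derivative_eq_intros dq[OF at0] dL[OF at0] dL1 refl)+
       (simp add: algebra_simps power2_eq_square deg deg[simplified])
  \<comment> \<open>The equation holds identically along the meridian, so its first two derivatives
    in the null direction vanish at the point.\<close>
  note zeroE = zero_function_second_derivative[OF \<delta> E1 E2 pde[folded K_def, folded L_def]]

  have E0: "q 0 0 0 * q 2 0 0 + c * ((q 0 1 0)\<^sup>2 + (q 1 0 0)\<^sup>2) + d = 0"
    using pde[OF at0] deg by simp
  \<comment> \<open>Otherwise the Laplacian would vanish at the point, leaving a sum of
    \<open>d\<close> and a gradient term whose sign never opposes that of \<open>d\<close>.\<close>
  have G: "q 2 0 0 \<noteq> 0"
  proof
    assume "q 2 0 0 = 0"
    then have "c * ((q 0 1 0)\<^sup>2 + (q 1 0 0)\<^sup>2) + d = 0" using E0 by simp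
    with cd show False
      by (smt (verit) mult_nonneg_nonneg mult_nonpos_nonneg sum_power2_ge_zero)
  qed
  \<comment> \<open>First-order minimum conditions: at the point the derivatives of the determinant
    are \<open>q 2 0 0\<close> times those of the null entry.\<close>
  have q12: "q 1 2 0 = 0" and q03: "q 0 3 0 = 0"
    using minP(1) minQ(1) G deg pq K0 by simp_all
  show False
  proof (rule degenerate_jet_contradiction[OF pos E0 _ _ _ cd])
    show "q 0 1 0 * q 2 0 0 + q 0 0 0 * (q 2 1 0 - q 0 1 0) = 0"
      using zeroE(1) deg q03 L0 by simp
    show "2 * q 0 1 0 * (q 2 1 0 - q 0 1 0) + q 0 0 0 * (q 0 4 0 + q 2 2 0) - 2 * c * (q 0 1 0)\<^sup>2 - 2 * d = 0"
      using zeroE(2) deg q03 q12 L0 by simp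
    \<comment> \<open>Sum of the second-order conditions on the two axes. The term in
      \<open>q 1 0 0\<close> stems from the Christoffel term of \<open>M\<close>.\<close>
    show "0 \<le> (q 0 4 0 + q 2 2 0) * q 2 0 0 - 2 * (q 2 1 0)\<^sup>2 - 2 * (q 1 0 0)\<^sup>2"
      using minP(2) minQ(2) deg q03 q12 pq K0 by (simp add: algebra_simps)
  qed
qed

section \<open>Covariant Hessian and Laplacian on the sphere\<close>

lemma geod_0 [simp]: "geod x X 0 = x"
  by (simp add: geod_def)

text \<open>The factor \<open>norm X\<close> from the chain rule undoes the normalisation of
  \<open>X\<close> in \<open>geod\<close>; for \<open>X = 0\<close> the curve is constant.\<close>

lemma geod_has_vector_derivative:
  "(geod x X has_vector_derivative
     (- sin (t * norm X) * norm X) *\<^sub>R x + cos (t * norm X) *\<^sub>R X) (at t)"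
  unfolding geod_def[abs_def]
  by (rule derivative_eq_intros refl has_vector_derivative_scaleR has_vector_derivative_add | (cases "X = 0"; force))+

lemma geod_velocity_has_vector_derivative:
  "((\<lambda>t. (- sin (t * norm X) * norm X) *\<^sub>R x + cos (t * norm X) *\<^sub>R X) has_vector_derivative
     - ((norm X)\<^sup>2 *\<^sub>R x)) (at 0)"
  by (rule derivative_eq_intros refl has_vector_derivative_scaleR has_vector_derivative_add | simp add: power2_eq_square)+

lemma norm_geod:
  assumes "norm x = 1" "X \<bullet> x = 0"
  shows "norm (geod x X t) = 1"
proof -
  define w where "w = X /\<^sub>R norm X"
  have "x \<bullet> x = 1" "x \<bullet> w = 0" "w \<bullet> x = 0"
    using assms by (simp_all add: w_def norm_eq_1 inner_commute)
  moreover have "w \<bullet> w = 1" if "X \<noteq> 0"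
    using that by (simp add: w_def dot_square_norm power2_eq_square)
  ultimately have "geod x X t \<bullet> geod x X t = (cos (t * norm X))\<^sup>2 + (sin (t * norm X))\<^sup>2"
    unfolding geod_def w_def[symmetric]
    by (cases "X = 0") (simp_all add: inner_add_left inner_add_right power2_eq_square)
  then show ?thesis by (simp add: norm_eq_1)
qed

text \<open>Along a great circle the velocity contributes \<open>D [X, X] x\<close>, and the
  acceleration, which points towards the centre, contributes the radial term. Covariant derivatives
  are thus expressed by ambient derivatives of an extension.\<close>

lemma hess_quad_eq:
  assumes D: "deriv_family U D" and "open U" and \<Omega>: "openin (top_of_set S2) \<Omega>" "\<Omega> \<subseteq> U"
    and v: "\<And>y. y \<in> \<Omega> \<Longrightarrow> D [] y = v y" and "x \<in> \<Omega>" "X \<in> tangent_S2 x"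
  shows "hess_quad v x X = D [X, X] x - (norm X)\<^sup>2 * D [x] x"
proof -
  obtain T where "open T" and T: "\<Omega> = S2 \<inter> T"
    using \<Omega>(1) by (auto simp: openin_open)
  have "norm x = 1" using \<open>x \<in> \<Omega>\<close> T by auto
  have X: "X \<bullet> x = 0" using assms(7) by (simp add: tangent_S2_def)
  define c' where "c' t = (- sin (t * norm X) * norm X) *\<^sub>R x + cos (t * norm X) *\<^sub>R X" for t
  have c: "(geod x X has_vector_derivative c' t) (at t)" for t
    unfolding c'_def by (rule geod_has_vector_derivative)
  have c'0: "c' 0 = X" by (simp add: c'_def)
  \<comment> \<open>Parameters at which the great circle lies in \<Omega>, where \<open>v\<close>
    and \<open>D []\<close> are known to agree.\<close>
  define N where "N = geod x X -` T"
  have "isCont (geod x X) t" for t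
    using has_vector_derivative_continuous[OF c] .
  then have "open N"
    unfolding N_def by (intro open_vimage \<open>open T\<close>) (simp add: continuous_on_eq_continuous_at)
  have "0 \<in> N" using \<open>x \<in> \<Omega>\<close> T by (auto simp: N_def)
  have in_\<Omega>: "geod x X t \<in> \<Omega>" if "t \<in> N" for t
    using that norm_geod[OF \<open>norm x = 1\<close> X] by (auto simp: N_def T)
  have d1: "deriv (\<lambda>t. v (geod x X t)) t = D [c' t] (geod x X t)" if "t \<in> N" for t
  proof (rule DERIV_imp_deriv)
    have "((\<lambda>t. D [] (geod x X t)) has_real_derivative D [c' t] (geod x X t)) (at t)"
      using deriv_family_along_curve[OF D _ c] in_\<Omega>[OF that] \<Omega>(2) by blast
    then show "((\<lambda>t. v (geod x X t)) has_real_derivative D [c' t] (geod x X t)) (at t)"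
      by (rule has_field_derivative_transform_within_open[OF _ \<open>open N\<close> that]) (simp add: v in_\<Omega>)
  qed
  have "((\<lambda>t. D [c' t] (geod x X t)) has_real_derivative
      D [- ((norm X)\<^sup>2 *\<^sub>R x)] (geod x X 0) + D [c' 0, c' 0] (geod x X 0)) (at 0)"
    by (rule deriv_family_field_along_curve[OF D \<open>open U\<close> _ c])
       (use geod_velocity_has_vector_derivative[of X x] \<open>x \<in> \<Omega>\<close> \<Omega> in \<open>auto simp: c'_def[abs_def]\<close>)
  then have "(deriv (\<lambda>t. v (geod x X t)) has_real_derivative
      D [- ((norm X)\<^sup>2 *\<^sub>R x)] x + D [X, X] x) (at 0)"
    using has_field_derivative_transform_within_open[OF _ \<open>open N\<close> \<open>0 \<in> N\<close>] d1 c'0 by simp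
  moreover have lin: "linear (\<lambda>h. D [h] x)"
    using deriv_family_linear[OF D] \<open>x \<in> \<Omega>\<close> \<Omega>(2) by blast
  have "D [- ((norm X)\<^sup>2 *\<^sub>R x)] x = - ((norm X)\<^sup>2 * D [x] x)"
    using linear_neg[OF lin] linear_cmul[OF lin] by simp
  ultimately show ?thesis
    unfolding hess_quad_def by (simp add: DERIV_imp_deriv)
qed

text \<open>Polarisation of \<open>hess_quad_eq\<close>; symmetry of second derivatives merges the
  mixed terms.\<close>

lemma cov_hess_eq:
  assumes D: "deriv_family U D" and "open U" and \<Omega>: "openin (top_of_set S2) \<Omega>" "\<Omega> \<subseteq> U"
    and v: "\<And>y. y \<in> \<Omega> \<Longrightarrow> D [] y = v y" and "x \<in> \<Omega>" "X \<in> tangent_S2 x" "Y \<in> tangent_S2 x"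
  shows "cov_hess v x X Y = D [X, Y] x - (X \<bullet> Y) * D [x] x"
proof -
  have "x \<in> U" using assms by blast
  have XY: "X + Y \<in> tangent_S2 x" "X - Y \<in> tangent_S2 x"
    using assms by (auto simp: tangent_S2_def inner_add_left inner_diff_left)
  note lin = deriv_family_linear[OF D \<open>x \<in> U\<close>] deriv_family_linear2[OF D \<open>open U\<close> \<open>x \<in> U\<close>]
  have "D [X + Y, X + Y] x = D [X, X] x + 2 * D [X, Y] x + D [Y, Y] x"
    using linear_add[OF lin(1)] linear_add[OF lin(2)] deriv_family_swap[OF D \<open>open U\<close> \<open>x \<in> U\<close>, of X Y]
    by simp
  moreover have "D [X - Y, X - Y] x = D [X, X] x - 2 * D [X, Y] x + D [Y, Y] x"
    using linear_diff[OF lin(1)] linear_diff[OF lin(2)] deriv_family_swap[OF D \<open>open U\<close> \<open>x \<in> U\<close>, of X Y]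
    by simp
  moreover have "(norm (X + Y))\<^sup>2 - (norm (X - Y))\<^sup>2 = 4 * (X \<bullet> Y)"
    by (simp add: power2_norm_eq_inner inner_add_left inner_add_right inner_diff_left inner_diff_right inner_commute)
  moreover have "hess_quad v x (X + Y) - hess_quad v x (X - Y) =
     D [X + Y, X + Y] x - D [X - Y, X - Y] x - ((norm (X + Y))\<^sup>2 - (norm (X - Y))\<^sup>2) * D [x] x"
    using hess_quad_eq[OF assms(1-6) XY(1)] hess_quad_eq[OF assms(1-6) XY(2)]
    by (simp add: algebra_simps)
  ultimately show ?thesis
    unfolding cov_hess_def by (simp add: field_simps)
qed

section \<open>Orthonormal frames and the trace of the Hessian\<close>

text \<open>A nonzero remainder after projection would be a fourth vector orthogonal to the three
  given ones, hence four independent vectors in dimension 3.\<close>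

lemma orthonormal_expansion_3:
  fixes x e f w :: "real^3"
  assumes "norm x = 1" "norm e = 1" "norm f = 1" "e \<bullet> x = 0" "f \<bullet> x = 0" "e \<bullet> f = 0"
  shows "w = (w \<bullet> x) *\<^sub>R x + (w \<bullet> e) *\<^sub>R e + (w \<bullet> f) *\<^sub>R f"
proof (rule ccontr)
  define r where "r = w - ((w \<bullet> x) *\<^sub>R x + (w \<bullet> e) *\<^sub>R e + (w \<bullet> f) *\<^sub>R f)"
  assume "w \<noteq> (w \<bullet> x) *\<^sub>R x + (w \<bullet> e) *\<^sub>R e + (w \<bullet> f) *\<^sub>R f"
  then have "r \<noteq> 0" by (simp add: r_def)
  have unit: "x \<bullet> x = 1" "e \<bullet> e = 1" "f \<bullet> f = 1"
    using assms by (simp_all add: norm_eq_1)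
  have sym: "x \<bullet> e = 0" "x \<bullet> f = 0" "f \<bullet> e = 0"
    using assms(4-6) by (simp_all add: inner_commute)
  have r: "r \<bullet> x = 0" "r \<bullet> e = 0" "r \<bullet> f = 0"
    using assms(4-6) unit sym by (simp_all add: r_def inner_diff_left inner_add_left)
  then have r': "x \<bullet> r = 0" "e \<bullet> r = 0" "f \<bullet> r = 0"
    by (simp_all only: inner_commute)
  let ?S = "{x, e, f, r}"
  have dist: "x \<noteq> e" "x \<noteq> f" "x \<noteq> r" "e \<noteq> f" "e \<noteq> r" "f \<noteq> r"
    using assms(4-6) unit r by (metis zero_neq_one)+
  have "independent ?S"
  proof (rule pairwise_orthogonal_independent)
    show "pairwise orthogonal ?S"
      unfolding pairwise_insert orthogonal_def using assms(4-6) sym r r' by auto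
    show "0 \<notin> ?S" using assms \<open>r \<noteq> 0\<close> by auto
  qed
  then have "card ?S \<le> 3" using independent_bound[of ?S] by simp
  then show False using dist by simp
qed

text \<open>The transition matrix between the two frames is orthogonal. Its column relations follow
  by expanding \<open>e\<close> and \<open>f\<close> back in \<open>E1\<close> and
  \<open>E2\<close>.\<close>

lemma orthonormal_trace_eq:
  fixes B :: "real^3 \<Rightarrow> real^3 \<Rightarrow> real"
  assumes B: "bilinear B" and sym: "\<And>a b. B a b = B b a"
    and E: "norm x = 1" "norm E1 = 1" "norm E2 = 1" "E1 \<bullet> x = 0" "E2 \<bullet> x = 0" "E1 \<bullet> E2 = 0"
    and e: "norm e = 1" "norm f = 1" "e \<bullet> x = 0" "f \<bullet> x = 0" "e \<bullet> f = 0"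
  shows "B E1 E1 + B E2 E2 = B e e + B f f"
proof -
  define a b c d where "a = E1 \<bullet> e" "b = E1 \<bullet> f" "c = E2 \<bullet> e" "d = E2 \<bullet> f"
  have E1: "E1 = a *\<^sub>R e + b *\<^sub>R f" and E2: "E2 = c *\<^sub>R e + d *\<^sub>R f"
    using orthonormal_expansion_3[OF E(1) e, of E1, unfolded E(4)]
      orthonormal_expansion_3[OF E(1) e, of E2, unfolded E(5)]
    unfolding a_b_c_d_def scaleR_zero_left add_0_left by blast+
  have e': "e = a *\<^sub>R E1 + c *\<^sub>R E2" and f': "f = b *\<^sub>R E1 + d *\<^sub>R E2"
    using orthonormal_expansion_3[OF E(1-6), of e, unfolded e(3)]
      orthonormal_expansion_3[OF E(1-6), of f, unfolded e(4)]
    unfolding a_b_c_d_def scaleR_zero_left add_0_left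
    by (simp_all only: inner_commute[of e] inner_commute[of f])
  have "e \<bullet> e = a * a + c * c" by (subst (1) e') (simp add: inner_add_left a_b_c_d_def)
  moreover have "f \<bullet> f = b * b + d * d" by (subst (1) f') (simp add: inner_add_left a_b_c_d_def)
  moreover have "e \<bullet> f = a * b + c * d" by (subst e') (simp add: inner_add_left a_b_c_d_def)
  ultimately have rel: "a * a + c * c = 1" "b * b + d * d = 1" "a * b + c * d = 0"
    using e by (simp_all add: norm_eq_1)
  have "B E1 E1 + B E2 E2 = (a * a + c * c) * B e e + 2 * (a * b + c * d) * B e f + (b * b + d * d) * B f f"
    unfolding E1 E2
    by (simp add: bilinear_ladd[OF B] bilinear_radd[OF B] bilinear_lmul[OF B] bilinear_rmul[OF B] sym[of f e]
        algebra_simps)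
  then show ?thesis using rel by simp
qed

text \<open>The cross product supplies the missing vector; its length follows from the Lagrange
  identity.\<close>

lemma orthonormal_completion:
  fixes x f :: "real^3"
  assumes "norm x = 1" "norm f = 1" "f \<bullet> x = 0"
  obtains e where "norm e = 1" "e \<bullet> x = 0" "e \<bullet> f = 0"
proof
  show "norm (cross3 f x) = 1"
    using assms norm_cross_dot[of f x] norm_ge_zero[of "cross3 f x"] by (auto simp: power2_eq_1_iff)
  show "cross3 f x \<bullet> x = 0" "cross3 f x \<bullet> f = 0"
    by (simp_all add: dot_cross_self)
qed

text \<open>The definition picks its frame by \<open>SOME\<close>; frame independence of the trace
  replaces it by any given frame. Each of the two unit vectors contributes one radial term.\<close>

lemma lb_laplacian_eq:
  assumes D: "deriv_family U D" and "open U" and \<Omega>: "openin (top_of_set S2) \<Omega>" "\<Omega> \<subseteq> U"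
    and v: "\<And>y. y \<in> \<Omega> \<Longrightarrow> D [] y = v y" and x: "x \<in> \<Omega>"
    and e: "norm e = 1" "norm f = 1" "e \<bullet> x = 0" "f \<bullet> x = 0" "e \<bullet> f = 0"
  shows "lb_laplacian v x = D [e, e] x + D [f, f] x - 2 * D [x] x"
proof -
  define P where "P = (\<lambda>(e1, e2). e1 \<in> tangent_S2 x \<and> e2 \<in> tangent_S2 x
        \<and> norm e1 = 1 \<and> norm e2 = 1 \<and> e1 \<bullet> e2 = 0)"
  \<comment> \<open>The given frame shows that the choice is not vacuous.\<close>
  have "P (e, f)" using e by (simp add: P_def tangent_S2_def)
  then have "P (SOME z. P z)" by (rule someI)
  then obtain E1 E2 where E12: "(SOME z. P z) = (E1, E2)" and "P (E1, E2)"
    by (metis surj_pair)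
  then have E: "E1 \<in> tangent_S2 x" "E2 \<in> tangent_S2 x" "norm E1 = 1" "norm E2 = 1"
      "E1 \<bullet> x = 0" "E2 \<bullet> x = 0" "E1 \<bullet> E2 = 0"
    by (auto simp: P_def tangent_S2_def)
  have "x \<in> U" "norm x = 1" using x \<Omega> openin_imp_subset by fastforce+
  have "lb_laplacian v x = cov_hess v x E1 E1 + cov_hess v x E2 E2"
    unfolding lb_laplacian_def P_def[symmetric] E12 by simp
  also have "\<dots> = D [E1, E1] x + D [E2, E2] x - 2 * D [x] x"
    using cov_hess_eq[OF assms(1-6)] E by (simp add: dot_square_norm)
  also have "D [E1, E1] x + D [E2, E2] x = D [e, e] x + D [f, f] x"
  proof (rule orthonormal_trace_eq[where B = "\<lambda>a b. D [a, b] x" and x = x])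
    show "bilinear (\<lambda>a b. D [a, b] x)"
      using deriv_family_linear[OF D \<open>x \<in> U\<close>] deriv_family_linear2[OF D \<open>open U\<close> \<open>x \<in> U\<close>]
      by (simp add: bilinear_def)
    show "D [a, b] x = D [b, a] x" for a b by (rule deriv_family_swap[OF D \<open>open U\<close> \<open>x \<in> U\<close>])
  qed (use E e \<open>norm x = 1\<close> in auto)
  finally show ?thesis by simp
qed

text \<open>Along \<open>X + t *\<^sub>R Y\<close> the Hessian is a quadratic polynomial in
  \<open>t\<close> of constant sign, which bounds its discriminant.\<close>

lemma cov_hess_det_nonneg:
  assumes D: "deriv_family U D" and "open U" and \<Omega>: "openin (top_of_set S2) \<Omega>" "\<Omega> \<subseteq> U"
    and v: "\<And>y. y \<in> \<Omega> \<Longrightarrow> D [] y = v y" and x: "x \<in> \<Omega>" "X \<in> tangent_S2 x" "Y \<in> tangent_S2 x"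
    and semi: "(\<forall>Z\<in>tangent_S2 x. cov_hess v x Z Z \<le> 0) \<or> (\<forall>Z\<in>tangent_S2 x. 0 \<le> cov_hess v x Z Z)"
  shows "0 \<le> cov_hess v x X X * cov_hess v x Y Y - (cov_hess v x X Y)\<^sup>2"
proof -
  have "x \<in> U" using assms by blast
  note lin = deriv_family_linear[OF D \<open>x \<in> U\<close>] deriv_family_linear2[OF D \<open>open U\<close> \<open>x \<in> U\<close>]
  define A B C where "A = cov_hess v x X X" "B = cov_hess v x X Y" "C = cov_hess v x Y Y"
  have Z: "X + t *\<^sub>R Y \<in> tangent_S2 x" for t
    using x by (auto simp: tangent_S2_def inner_add_left)
  have quad: "cov_hess v x (X + t *\<^sub>R Y) (X + t *\<^sub>R Y) = A + 2 * t * B + t\<^sup>2 * C" for t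
  proof -
    have "cov_hess v x (X + t *\<^sub>R Y) (X + t *\<^sub>R Y)
        = D [X + t *\<^sub>R Y, X + t *\<^sub>R Y] x - ((X + t *\<^sub>R Y) \<bullet> (X + t *\<^sub>R Y)) * D [x] x"
      by (rule cov_hess_eq[OF assms(1-6) Z Z])
    also have "D [X + t *\<^sub>R Y, X + t *\<^sub>R Y] x = D [X, X] x + 2 * t * D [X, Y] x + t\<^sup>2 * D [Y, Y] x"
      unfolding linear_add[OF lin(1)] linear_add[OF lin(2)] linear_cmul[OF lin(1)] linear_cmul[OF lin(2)]
      using deriv_family_swap[OF D \<open>open U\<close> \<open>x \<in> U\<close>, of Y X "[]"]
      by (simp add: algebra_simps power2_eq_square)
    also have "(X + t *\<^sub>R Y) \<bullet> (X + t *\<^sub>R Y) = X \<bullet> X + 2 * t * (X \<bullet> Y) + t\<^sup>2 * (Y \<bullet> Y)"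
      by (simp add: inner_add_left inner_add_right inner_commute[of Y X] algebra_simps power2_eq_square)
    finally show ?thesis
      unfolding A_B_C_def using cov_hess_eq[OF assms(1-6)] x by (simp add: ring_distribs)
  qed
  have discr: "B\<^sup>2 \<le> A * C" if nonneg: "\<And>t. 0 \<le> A + 2 * t * B + t\<^sup>2 * C" and "0 \<le> C" for A B C :: real
  proof (cases "C = 0")
    case True
    have "B = 0"
    proof (rule ccontr)
      assume "B \<noteq> 0"
      \<comment> \<open>For \<open>C = 0\<close> the polynomial is affine, and this \<open>t\<close>
        gives it the value -1.\<close>
      then show False using nonneg[of "- (A + 1) / (2 * B)"] True by (simp add: field_simps)
    qed
    then show ?thesis using True by simp
  next
    case False
    then have "C > 0" using that by simp
    \<comment> \<open>\<open>- B / C\<close> is the minimiser of the polynomial.\<close>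
    then have "0 \<le> C * (A + 2 * (- B / C) * B + (- B / C)\<^sup>2 * C)"
      using nonneg[of "- B / C"] by (intro mult_nonneg_nonneg) auto
    also have "\<dots> = A * C - B\<^sup>2"
      using \<open>C > 0\<close> by (simp add: field_simps power2_eq_square)
    finally show ?thesis by simp
  qed
  from semi have "B\<^sup>2 \<le> A * C"
  proof
    assume *: "\<forall>Z\<in>tangent_S2 x. cov_hess v x Z Z \<le> 0"
    then have "0 \<le> - A + 2 * t * (- B) + t\<^sup>2 * (- C)" for t
      using quad[of t] Z[of t] by force
    moreover have "0 \<le> - C" using * x by (simp add: A_B_C_def)
    ultimately show ?thesis using discr[of "- A" "- B" "- C"] by simp
  next
    assume *: "\<forall>Z\<in>tangent_S2 x. 0 \<le> cov_hess v x Z Z"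
    then have "0 \<le> A + 2 * t * B + t\<^sup>2 * C" for t
      using quad[of t] Z[of t] by force
    moreover have "0 \<le> C" using * x by (simp add: A_B_C_def)
    ultimately show ?thesis using discr[of A B C] by simp
  qed
  then show ?thesis by (simp add: A_B_C_def)
qed

section \<open>The Hessian in geographic coordinates\<close>

text \<open>For an orthonormal triple \<open>q\<close>, \<open>e\<close>, \<open>f\<close>,
  \<open>m\<close> is the point of the equator on the same meridian, and \<open>n\<close> and
  \<open>Xt\<close> are the unit tangents to the parallel and the meridian. The last formula is the
  geodesic equation of the meridians.\<close>

lemma geo_chart_line_derivatives:
  fixes q e f :: "real^3"
  assumes ef: "e \<bullet> e = 1" "f \<bullet> f = 1" "e \<bullet> f = 0"
  defines "m \<equiv> \<lambda>y. cos (y \<bullet> e) *\<^sub>R q + sin (y \<bullet> e) *\<^sub>R e"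
    and "n \<equiv> \<lambda>y. - sin (y \<bullet> e) *\<^sub>R q + cos (y \<bullet> e) *\<^sub>R e"
  defines "Xt \<equiv> \<lambda>y. - sin (y \<bullet> f) *\<^sub>R m y + cos (y \<bullet> f) *\<^sub>R f"
  shows "((\<lambda>\<tau>. geo_chart q e f (y + \<tau> *\<^sub>R e)) has_vector_derivative cos (y \<bullet> f) *\<^sub>R n y) (at 0)"
    and "((\<lambda>\<tau>. geo_chart q e f (y + \<tau> *\<^sub>R f)) has_vector_derivative Xt y) (at 0)"
    and "((\<lambda>\<tau>. cos ((y + \<tau> *\<^sub>R e) \<bullet> f) *\<^sub>R n (y + \<tau> *\<^sub>R e)) has_vector_derivative - cos (y \<bullet> f) *\<^sub>R m y) (at 0)"
    and "((\<lambda>\<tau>. Xt (y + \<tau> *\<^sub>R e)) has_vector_derivative - sin (y \<bullet> f) *\<^sub>R n y) (at 0)"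
    and "((\<lambda>\<tau>. Xt (y + \<tau> *\<^sub>R f)) has_vector_derivative - geo_chart q e f y) (at 0)"
proof -
  have fe: "f \<bullet> e = 0" using ef by (simp add: inner_commute)
  note simps = geo_chart_def m_def n_def Xt_def inner_add_left inner_scaleR_left ef fe
  note rules = derivative_eq_intros refl has_vector_derivative_scaleR has_vector_derivative_add
  show "((\<lambda>\<tau>. geo_chart q e f (y + \<tau> *\<^sub>R e)) has_vector_derivative cos (y \<bullet> f) *\<^sub>R n y) (at 0)"
    unfolding simps by (rule rules | simp add: algebra_simps ef fe)+
  show "((\<lambda>\<tau>. geo_chart q e f (y + \<tau> *\<^sub>R f)) has_vector_derivative Xt y) (at 0)"
    unfolding simps by (rule rules | simp add: algebra_simps ef fe)+
  show "((\<lambda>\<tau>. cos ((y + \<tau> *\<^sub>R e) \<bullet> f) *\<^sub>R n (y + \<tau> *\<^sub>R e)) has_vector_derivative - cos (y \<bullet> f) *\<^sub>R m y) (at 0)"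
    unfolding simps by (rule rules | simp add: algebra_simps ef fe)+
  show "((\<lambda>\<tau>. Xt (y + \<tau> *\<^sub>R e)) has_vector_derivative - sin (y \<bullet> f) *\<^sub>R n y) (at 0)"
    unfolding simps by (rule rules | simp add: algebra_simps ef fe)+
  show "((\<lambda>\<tau>. Xt (y + \<tau> *\<^sub>R f)) has_vector_derivative - geo_chart q e f y) (at 0)"
    unfolding simps by (rule rules | simp add: algebra_simps ef fe)+
qed

text \<open>Differentiating twice through the chart yields ambient second derivatives plus the
  acceleration of the chart. Its component along \<open>x\<close> is the radial term of the
  covariant Hessian; its components along \<open>n\<close> and \<open>k\<close> are the Christoffel
  terms on the left.\<close>

lemma geo_chart_partials:
  fixes q e f :: "real^3"
  assumes D: "deriv_family U D" and "open U"
    and E: "deriv_family W E" and W: "W = geo_chart q e f -` U" "open W"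
    and ED: "E [] = (\<lambda>y. D [] (geo_chart q e f y))"
    and ef: "e \<bullet> e = 1" "f \<bullet> f = 1" "e \<bullet> f = 0" and y: "y \<in> W"
  defines "x \<equiv> geo_chart q e f y" and "S \<equiv> sin (y \<bullet> f)" and "C \<equiv> cos (y \<bullet> f)"
    and "n \<equiv> - sin (y \<bullet> e) *\<^sub>R q + cos (y \<bullet> e) *\<^sub>R e"
    and "k \<equiv> - sin (y \<bullet> f) *\<^sub>R (cos (y \<bullet> e) *\<^sub>R q + sin (y \<bullet> e) *\<^sub>R e) + cos (y \<bullet> f) *\<^sub>R f"
  shows "E [e] y = C * D [n] x" and "E [f] y = D [k] x"
    and "E [e, e] y - S * C * E [f] y = C\<^sup>2 * (D [n, n] x - D [x] x)"
    and "C * E [e, f] y + S * E [e] y = C\<^sup>2 * D [n, k] x"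
    and "E [f, f] y = D [k, k] x - D [x] x"
proof -
  let ?\<Xi> = "geo_chart q e f"
  let ?m = "\<lambda>y. cos (y \<bullet> e) *\<^sub>R q + sin (y \<bullet> e) *\<^sub>R e"
  let ?n = "\<lambda>y. - sin (y \<bullet> e) *\<^sub>R q + cos (y \<bullet> e) *\<^sub>R e"
  let ?k = "\<lambda>y. - sin (y \<bullet> f) *\<^sub>R ?m y + cos (y \<bullet> f) *\<^sub>R f"
  define m where "m = ?m y"
  note lines = geo_chart_line_derivatives[OF ef, where q = q]
  note at0 = scaleR_zero_left add_0_right
  have inU: "?\<Xi> (z + 0 *\<^sub>R a) \<in> U" if "z \<in> W" for z a using that W by simp
  have E0: "E [] z = D [] (?\<Xi> z)" for z by (simp add: ED)
  have Ee: "E [e] z = D [cos (z \<bullet> f) *\<^sub>R ?n z] (?\<Xi> z)" if "z \<in> W" for z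
    using deriv_family_line[OF E \<open>open W\<close> that E0 deriv_family_along_curve[OF D inU[OF that] lines(1)]]
    unfolding at0 .
  have Ef: "E [f] z = D [?k z] (?\<Xi> z)" if "z \<in> W" for z
    using deriv_family_line[OF E \<open>open W\<close> that E0 deriv_family_along_curve[OF D inU[OF that] lines(2)]]
    unfolding at0 .
  have Eee: "E [e, e] y = D [- C *\<^sub>R m] x + D [C *\<^sub>R n, C *\<^sub>R n] x"
    using deriv_family_line[OF E \<open>open W\<close> y Ee
        deriv_family_field_along_curve[OF D \<open>open U\<close> inU[OF y] lines(1) lines(3)]]
    unfolding at0 x_def C_def n_def m_def .
  have Eef: "E [e, f] y = D [- S *\<^sub>R n] x + D [C *\<^sub>R n, k] x"
    using deriv_family_line[OF E \<open>open W\<close> y Ef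
        deriv_family_field_along_curve[OF D \<open>open U\<close> inU[OF y] lines(1) lines(4)]]
    unfolding at0 x_def C_def S_def n_def k_def .
  have Eff: "E [f, f] y = D [- x] x + D [k, k] x"
    using deriv_family_line[OF E \<open>open W\<close> y Ef
        deriv_family_field_along_curve[OF D \<open>open U\<close> inU[OF y] lines(2) lines(5)]]
    unfolding at0 x_def k_def .
  have "x \<in> U" using y W by (simp add: x_def)
  note lin = deriv_family_linear[OF D \<open>x \<in> U\<close>] deriv_family_linear2[OF D \<open>open U\<close> \<open>x \<in> U\<close>]
  have x: "x = C *\<^sub>R m + S *\<^sub>R f"
    by (simp add: x_def geo_chart_def C_def S_def m_def scaleR_add_right)
  have k': "k = - S *\<^sub>R m + C *\<^sub>R f"
    by (simp add: k_def S_def C_def m_def)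
  note lins = linear_add[OF lin(1)] linear_cmul[OF lin(1)] linear_neg[OF lin(1)] linear_cmul[OF lin(2)] real_scaleR_def
  show "E [e] y = C * D [n] x"
    using Ee[OF y] linear_cmul[OF lin(1)] unfolding x_def C_def n_def by simp
  then have Ee': "E [e] y = C * D [n] x" .
  show "E [f] y = D [k] x"
    using Ef[OF y] unfolding x_def k_def .
  then have Ef': "E [f] y = D [k] x" .
  \<comment> \<open>Inverting the rotation that takes \<open>m\<close>, \<open>f\<close> to
    \<open>x\<close>, \<open>k\<close> gives
    \<open>m = C *\<^sub>R x - S *\<^sub>R k\<close>.\<close>
  have "- C *\<^sub>R m = - (C\<^sup>2) *\<^sub>R x + (S * C) *\<^sub>R k"
  proof -
    have "- (C\<^sup>2) *\<^sub>R x + (S * C) *\<^sub>R k = (- (C * (C\<^sup>2 + S\<^sup>2))) *\<^sub>R m"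
      unfolding x k' by (simp add: algebra_simps power2_eq_square)
    then show ?thesis by (simp add: C_def S_def)
  qed
  then have "D [- C *\<^sub>R m] x = - (C\<^sup>2) * D [x] x + S * C * D [k] x"
    by (simp only: lins)
  then show "E [e, e] y - S * C * E [f] y = C\<^sup>2 * (D [n, n] x - D [x] x)"
    unfolding Eee Ef' lins by (simp add: algebra_simps power2_eq_square)
  show "C * E [e, f] y + S * E [e] y = C\<^sup>2 * D [n, k] x"
    unfolding Eef Ee' lins by (simp add: algebra_simps power2_eq_square)
  show "E [f, f] y = D [k, k] x - D [x] x"
    unfolding Eff lins by simp
qed

text \<open>\<open>x\<close>, \<open>n\<close>, \<open>k\<close> arise from \<open>q\<close>,
  \<open>e\<close>, \<open>f\<close> by two rotations, by the longitude and then by the latitude,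
  and so stay orthonormal.\<close>

lemma geo_chart_frame:
  fixes q e f y :: "real^3"
  assumes "q \<bullet> q = 1" "e \<bullet> e = 1" "f \<bullet> f = 1" "e \<bullet> f = 0" "e \<bullet> q = 0" "f \<bullet> q = 0"
  defines "x \<equiv> geo_chart q e f y"
    and "n \<equiv> - sin (y \<bullet> e) *\<^sub>R q + cos (y \<bullet> e) *\<^sub>R e"
    and "k \<equiv> - sin (y \<bullet> f) *\<^sub>R (cos (y \<bullet> e) *\<^sub>R q + sin (y \<bullet> e) *\<^sub>R e) + cos (y \<bullet> f) *\<^sub>R f"
  shows "norm x = 1" "norm n = 1" "norm k = 1" "n \<bullet> x = 0" "k \<bullet> x = 0" "n \<bullet> k = 0"
proof -
  have sym: "f \<bullet> e = 0" "q \<bullet> e = 0" "q \<bullet> f = 0"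
    using assms(4-6) by (simp_all add: inner_commute)
  note simps = x_def n_def k_def geo_chart_def inner_add_left inner_add_right assms(1-6) sym norm_eq_1
  have s: "(sin t)\<^sup>2 = 1 - (cos t)\<^sup>2" for t :: real by (simp add: sin_squared_eq)
  have sc: "sin t * sin t = 1 - cos t * cos t" for t :: real
    using s[of t] by (simp add: power2_eq_square)
  show "norm x = 1" "norm n = 1" "norm k = 1" "n \<bullet> x = 0" "k \<bullet> x = 0" "n \<bullet> k = 0"
    unfolding simps by (simp_all add: simps, (use sc[of "y \<bullet> e"] sc[of "y \<bullet> f"] in algebra)+)
qed

section \<open>Nondegeneracy\<close>

text \<open>The exponent \<gamma> is chosen to make the source term constant, and the coefficient of
  the squared gradient compensates the second derivative of the power function.\<close>

lemma powr_equation: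
  assumes D: "deriv_family U D" and "open U" and pos: "\<And>x. x \<in> U \<Longrightarrow> D [] x > 0"
    and E: "deriv_family U E" and ED: "E [] = (\<lambda>x. D [] x powr \<gamma>)"
    and \<gamma>: "\<gamma> = (1 - p) / 2" "\<gamma> \<noteq> 0" and "x \<in> U"
    and eq: "D [a, a] x + D [b, b] x - 2 * D [x] x = - (D [] x powr p)"
  shows "E [] x * (E [a, a] x + E [b, b] x - 2 * E [x] x)
      + (1 - \<gamma>) / \<gamma> * ((E [a] x)\<^sup>2 + (E [b] x)\<^sup>2) + \<gamma> = 0"
proof -
  have line: "((\<lambda>\<tau>. z + \<tau> *\<^sub>R h) has_vector_derivative h) (at 0)" for z h :: "real^3"
    by (auto intro!: derivative_eq_intros)
  have dD: "((\<lambda>\<tau>. D ds (z + \<tau> *\<^sub>R h)) has_real_derivative D (h # ds) z) (at 0)" if "z \<in> U" for z h ds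
    using deriv_family_along_curve[OF D _ line[of z h], of ds] that by simp
  have dpowr: "((\<lambda>\<tau>. D [] (z + \<tau> *\<^sub>R h) powr r) has_real_derivative r * (D [] z powr (r - 1) * D [h] z)) (at 0)"
    if "z \<in> U" for z h r
    using DERIV_fun_powr[OF dD[OF that, of "[]" h], of r] pos[OF that] by (simp add: mult.assoc)
  have E1: "E [h] z = \<gamma> * (D [] z powr (\<gamma> - 1) * D [h] z)" if "z \<in> U" for h z
    using deriv_family_line[OF E \<open>open U\<close> that _ dpowr[OF that], of "[]"] ED by simp
  have E2: "E [h, h] x = \<gamma> * ((\<gamma> - 1) * (D [] x powr (\<gamma> - 2) * (D [h] x)\<^sup>2) + D [] x powr (\<gamma> - 1) * D [h, h] x)" for h
  proof (rule deriv_family_line[OF E \<open>open U\<close> \<open>x \<in> U\<close> E1])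
    have "((\<lambda>\<tau>. \<gamma> * (D [] (x + \<tau> *\<^sub>R h) powr (\<gamma> - 1) * D [h] (x + \<tau> *\<^sub>R h))) has_real_derivative
        \<gamma> * ((\<gamma> - 1) * (D [] x powr (\<gamma> - 1 - 1) * D [h] x) * D [h] (x + 0 *\<^sub>R h)
          + D [h, h] x * D [] (x + 0 *\<^sub>R h) powr (\<gamma> - 1))) (at 0)"
      by (intro DERIV_cmult DERIV_mult dpowr dD \<open>x \<in> U\<close>)
    then show "((\<lambda>\<tau>. \<gamma> * (D [] (x + \<tau> *\<^sub>R h) powr (\<gamma> - 1) * D [h] (x + \<tau> *\<^sub>R h))) has_real_derivative
        \<gamma> * ((\<gamma> - 1) * (D [] x powr (\<gamma> - 2) * (D [h] x)\<^sup>2) + D [] x powr (\<gamma> - 1) * D [h, h] x)) (at 0)"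
      by (simp add: power2_eq_square algebra_simps)
  qed
  define g where "g = D [] x"
  define V where "V = g powr \<gamma>"
  have "g > 0" using pos[OF \<open>x \<in> U\<close>] by (simp add: g_def)
  have p1: "g powr (\<gamma> - 1) = V / g" using \<open>g > 0\<close> by (simp add: V_def powr_diff)
  have p2: "g powr (\<gamma> - 2) = V / g\<^sup>2" using \<open>g > 0\<close> by (simp add: V_def powr_diff)
  \<comment> \<open>Here the choice of \<gamma> enters: it gives
    \<open>2 * \<gamma> + p = 1\<close>.\<close>
  have "V * V * g powr p = g powr (\<gamma> + \<gamma> + p)" by (simp only: V_def powr_add)
  also have "\<gamma> + \<gamma> + p = 1" using \<gamma> by simp
  finally have VV: "V * V * g powr p = g" using \<open>g > 0\<close> by simp
  have E1': "E [h] x = \<gamma> * V / g * D [h] x" for h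
    using E1[OF \<open>x \<in> U\<close>, of h] p1 by (simp add: g_def)
  have E2': "E [h, h] x = \<gamma> * (\<gamma> - 1) * V / g\<^sup>2 * (D [h] x)\<^sup>2 + \<gamma> * V / g * D [h, h] x" for h
    using E2[of h] unfolding g_def[symmetric] p1 p2 by (simp add: algebra_simps diff_divide_distrib)
  have "E [a, a] x + E [b, b] x - 2 * E [x] x
      = \<gamma> * (\<gamma> - 1) * V / g\<^sup>2 * ((D [a] x)\<^sup>2 + (D [b] x)\<^sup>2) + \<gamma> * V / g * (D [a, a] x + D [b, b] x - 2 * D [x] x)"
    unfolding E1' E2' by (simp add: algebra_simps add_divide_distrib diff_divide_distrib)
  also have "\<dots> = \<gamma> * (\<gamma> - 1) * V / g\<^sup>2 * ((D [a] x)\<^sup>2 + (D [b] x)\<^sup>2) - \<gamma> * V / g * g powr p"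
    unfolding eq by (simp add: g_def)
  finally have trace: "E [a, a] x + E [b, b] x - 2 * E [x] x
      = \<gamma> * (\<gamma> - 1) * V / g\<^sup>2 * ((D [a] x)\<^sup>2 + (D [b] x)\<^sup>2) - \<gamma> * V / g * g powr p" .
  have "V * (E [a, a] x + E [b, b] x - 2 * E [x] x)
      = \<gamma> * (\<gamma> - 1) * V\<^sup>2 / g\<^sup>2 * ((D [a] x)\<^sup>2 + (D [b] x)\<^sup>2) - \<gamma> / g * (V * V * g powr p)"
    unfolding trace by (simp add: algebra_simps power2_eq_square add_divide_distrib diff_divide_distrib)
  also have "\<dots> = \<gamma> * (\<gamma> - 1) * V\<^sup>2 / g\<^sup>2 * ((D [a] x)\<^sup>2 + (D [b] x)\<^sup>2) - \<gamma>"
    unfolding VV using \<open>g > 0\<close> by simp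
  finally have *: "V * (E [a, a] x + E [b, b] x - 2 * E [x] x)
      = \<gamma> * (\<gamma> - 1) * V\<^sup>2 / g\<^sup>2 * ((D [a] x)\<^sup>2 + (D [b] x)\<^sup>2) - \<gamma>" .
  have **: "(1 - \<gamma>) / \<gamma> * ((E [a] x)\<^sup>2 + (E [b] x)\<^sup>2)
      = - (\<gamma> * (\<gamma> - 1) * V\<^sup>2 / g\<^sup>2 * ((D [a] x)\<^sup>2 + (D [b] x)\<^sup>2))"
    unfolding E1' using \<gamma>(2) \<open>g > 0\<close> by (simp add: field_simps power2_eq_square)
  have "E [] x = V" by (simp add: ED V_def g_def)
  then show ?thesis using * ** by simp
qed

text \<open>A null vector at \<open>q\<close> becomes the meridian direction of a chart centred at
  \<open>q\<close>, which reduces the claim to \<open>degenerate_hessian_contradiction\<close>. The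
  equation is assumed for every orthonormal frame because the frame of the chart varies with the
  point.\<close>

lemma cov_hess_nondegenerate:
  assumes D: "deriv_family U D" and "open U" and \<Omega>: "openin (top_of_set S2) \<Omega>" "\<Omega> \<subseteq> U"
    and v: "\<And>y. y \<in> \<Omega> \<Longrightarrow> D [] y = v y" and pos: "\<And>y. y \<in> \<Omega> \<Longrightarrow> v y > 0"
    and semi: "\<And>y. y \<in> \<Omega> \<Longrightarrow>
      (\<forall>Z\<in>tangent_S2 y. cov_hess v y Z Z \<le> 0) \<or> (\<forall>Z\<in>tangent_S2 y. 0 \<le> cov_hess v y Z Z)"
    and pde: "\<And>y a b. y \<in> \<Omega> \<Longrightarrow> norm a = 1 \<Longrightarrow> norm b = 1 \<Longrightarrow> a \<bullet> y = 0 \<Longrightarrow> b \<bullet> y = 0 \<Longrightarrow> a \<bullet> b = 0 \<Longrightarrow>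
      D [] y * (D [a, a] y + D [b, b] y - 2 * D [y] y) + c * ((D [a] y)\<^sup>2 + (D [b] y)\<^sup>2) + d = 0"
    and cd: "(0 \<le> c \<and> 0 < d) \<or> (c \<le> -2 \<and> d < 0)"
    and q: "q \<in> \<Omega>" and X: "X \<in> tangent_S2 q" "\<forall>Y\<in>tangent_S2 q. cov_hess v q X Y = 0"
  shows "X = 0"
proof (rule ccontr)
  assume "X \<noteq> 0"
  define f where "f = X /\<^sub>R norm X"
  have "norm q = 1" using q \<Omega>(1) openin_imp_subset by fastforce
  have f: "norm f = 1" "f \<bullet> q = 0" using \<open>X \<noteq> 0\<close> X by (auto simp: f_def tangent_S2_def)
  obtain e where e: "norm e = 1" "e \<bullet> q = 0" "e \<bullet> f = 0"
    using orthonormal_completion[OF \<open>norm q = 1\<close> f] by blast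
  have unit: "q \<bullet> q = 1" "e \<bullet> e = 1" "f \<bullet> f = 1" "e \<bullet> f = 0" "e \<bullet> q = 0" "f \<bullet> q = 0" "f \<bullet> e = 0"
    using e f \<open>norm q = 1\<close> by (auto simp: norm_eq_1 inner_commute)
  have "q \<in> U" using q \<Omega> by blast
  have tan: "e \<in> tangent_S2 q" "f \<in> tangent_S2 q" using unit by (auto simp: tangent_S2_def)
  \<comment> \<open>The null condition in ambient derivatives, for the normalised null
    vector.\<close>
  have null: "D [Y, f] q - (Y \<bullet> f) * D [q] q = 0" if "Y \<in> tangent_S2 q" for Y
  proof -
    note lin = deriv_family_linear2[OF D \<open>open U\<close> \<open>q \<in> U\<close>, of Y "[]"]
    have "cov_hess v q Y X = 0"
      using X that cov_hess_eq[OF assms(1-5) q] deriv_family_swap[OF D \<open>open U\<close> \<open>q \<in> U\<close>]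
      by (metis inner_commute)
    then have "D [Y, X] q - (Y \<bullet> X) * D [q] q = 0"
      using cov_hess_eq[OF assms(1-5) q that X(1)] by simp
    moreover have "D [Y, f] q = D [Y, X] q / norm X" "Y \<bullet> f = (Y \<bullet> X) / norm X"
      using linear_cmul[OF lin] by (simp_all add: f_def divide_inverse_commute)
    ultimately show ?thesis by simp
  qed
  let ?\<Xi> = "geo_chart q e f"
  define W where "W = ?\<Xi> -` U"
  have cont: "continuous_on UNIV ?\<Xi>"
    using has_derivative_continuous[OF has_derivative_geo_chart[of q e f]]
    by (simp add: continuous_on_eq_continuous_at)
  have "open W" unfolding W_def by (intro open_vimage \<open>open U\<close> cont)
  obtain E where E: "deriv_family W E" and ED: "E [] = (\<lambda>y. D [] (?\<Xi> y))"
    using deriv_family_geo_chart[OF D] unfolding W_def by blast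
  obtain T where "open T" and T: "\<Omega> = S2 \<inter> T"
    using \<Omega>(1) by (auto simp: openin_open)
  have "open (?\<Xi> -` T)" by (intro open_vimage \<open>open T\<close> cont)
  moreover have \<Xi>0: "?\<Xi> 0 = q" by (simp add: geo_chart_def)
  then have "0 \<in> ?\<Xi> -` T" using q T by simp
  ultimately obtain \<delta> where "\<delta> > 0" and \<delta>: "\<And>y. norm y < \<delta> \<Longrightarrow> ?\<Xi> y \<in> T"
    unfolding open_dist by (metis dist_0_norm dist_commute vimage_eq)
  note frame = geo_chart_frame[OF unit(1-6)]
  have in_\<Omega>: "?\<Xi> y \<in> \<Omega>" and in_W: "y \<in> W" if "norm y < \<delta>" for y
    using \<delta>[OF that] frame(1)[of y] \<Omega>(2) by (auto simp: T W_def)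
  \<comment> \<open>Derivatives in \<open>e\<close> are taken last: one more \<open>e\<close> is
    simply prepended, while one more \<open>f\<close> has to be moved past them.\<close>
  define P where "P i j = E (replicate i e @ replicate j f)" for i j
  have P: "P 0 0 = E []" "P 0 1 = E [f]" "P 1 0 = E [e]" "P 2 0 = E [e, e]" "P 1 1 = E [e, f]" "P 0 2 = E [f, f]"
    by (simp_all add: P_def numeral_2_eq_2)
  have det: "0 \<le> (cos (y \<bullet> f))\<^sup>2 * P 0 2 y * (P 2 0 y - sin (y \<bullet> f) * cos (y \<bullet> f) * P 0 1 y)
        - (cos (y \<bullet> f) * P 1 1 y + sin (y \<bullet> f) * P 1 0 y)\<^sup>2"
    and eq: "P 0 0 y * ((cos (y \<bullet> f))\<^sup>2 * P 0 2 y + (P 2 0 y - sin (y \<bullet> f) * cos (y \<bullet> f) * P 0 1 y))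
        + c * ((cos (y \<bullet> f))\<^sup>2 * (P 0 1 y)\<^sup>2 + (P 1 0 y)\<^sup>2) + d * (cos (y \<bullet> f))\<^sup>2 = 0"
    if "norm y < \<delta>" for y
  proof -
    define x where "x = ?\<Xi> y"
    define C where "C = cos (y \<bullet> f)"
    define n where "n = - sin (y \<bullet> e) *\<^sub>R q + cos (y \<bullet> e) *\<^sub>R e"
    define k where "k = - sin (y \<bullet> f) *\<^sub>R (cos (y \<bullet> e) *\<^sub>R q + sin (y \<bullet> e) *\<^sub>R e) + cos (y \<bullet> f) *\<^sub>R f"
    note fr = frame[of y, folded x_def n_def k_def]
    note part = geo_chart_partials[OF D \<open>open U\<close> E W_def \<open>open W\<close> ED unit(2-4) in_W[OF that],
        folded x_def C_def n_def k_def]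
    have x: "x \<in> \<Omega>" using in_\<Omega>[OF that] by (simp add: x_def)
    have nk: "n \<in> tangent_S2 x" "k \<in> tangent_S2 x" using fr by (auto simp: tangent_S2_def)
    have "0 \<le> cov_hess v x n n * cov_hess v x k k - (cov_hess v x n k)\<^sup>2"
      by (rule cov_hess_det_nonneg[OF assms(1-5) x nk semi[OF x]])
    also have "\<dots> = (D [n, n] x - D [x] x) * (D [k, k] x - D [x] x) - (D [n, k] x)\<^sup>2"
      using cov_hess_eq[OF assms(1-5) x] nk fr by (simp add: dot_square_norm)
    \<comment> \<open>The even power keeps the sign and supplies the factors that
      \<open>part(3-5)\<close> absorb.\<close>
    finally have "0 \<le> C ^ 4 * ((D [n, n] x - D [x] x) * (D [k, k] x - D [x] x) - (D [n, k] x)\<^sup>2)"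
      by (intro mult_nonneg_nonneg) auto
    also have "\<dots> = C\<^sup>2 * (D [k, k] x - D [x] x) * (C\<^sup>2 * (D [n, n] x - D [x] x)) - (C\<^sup>2 * D [n, k] x)\<^sup>2"
      by (simp add: algebra_simps power2_eq_square power4_eq_xxxx)
    finally show "0 \<le> (cos (y \<bullet> f))\<^sup>2 * P 0 2 y * (P 2 0 y - sin (y \<bullet> f) * cos (y \<bullet> f) * P 0 1 y)
        - (cos (y \<bullet> f) * P 1 1 y + sin (y \<bullet> f) * P 1 0 y)\<^sup>2"
      unfolding P C_def[symmetric] part(3-5) .
    have "D [] x * (D [n, n] x + D [k, k] x - 2 * D [x] x) + c * ((D [n] x)\<^sup>2 + (D [k] x)\<^sup>2) + d = 0"
      by (rule pde[OF x]) (use fr in auto)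
    then have "C\<^sup>2 * (D [] x * (D [n, n] x + D [k, k] x - 2 * D [x] x) + c * ((D [n] x)\<^sup>2 + (D [k] x)\<^sup>2) + d) = 0"
      by simp
    then show "P 0 0 y * ((cos (y \<bullet> f))\<^sup>2 * P 0 2 y + (P 2 0 y - sin (y \<bullet> f) * cos (y \<bullet> f) * P 0 1 y))
        + c * ((cos (y \<bullet> f))\<^sup>2 * (P 0 1 y)\<^sup>2 + (P 1 0 y)\<^sup>2) + d * (cos (y \<bullet> f))\<^sup>2 = 0"
      unfolding P C_def[symmetric] part(3) unfolding part(1,2,5) ED x_def[symmetric]
      by (simp add: algebra_simps power2_eq_square)
  qed
  have line: "((\<lambda>\<tau>. \<tau> *\<^sub>R a) has_vector_derivative a) (at t)" for a :: "real^3" and t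
    by (auto intro!: derivative_eq_intros)
  show False
  proof (rule degenerate_hessian_contradiction[where p = "\<lambda>i j s. P i j (s *\<^sub>R e)" and q = "\<lambda>i j t. P i j (t *\<^sub>R f)",
        OF \<open>\<delta> > 0\<close> _ _ _ _ _ _ _ _ _ cd])
    fix i j and t :: real assume t: "\<bar>t\<bar> < \<delta>"
    show "((\<lambda>s. P i j (s *\<^sub>R e)) has_real_derivative P (Suc i) j (t *\<^sub>R e)) (at t)"
      using deriv_family_along_curve[OF E _ line, where ds = "replicate i e @ replicate j f"] in_W t e
      by (simp add: P_def)
    have "P i (Suc j) (t *\<^sub>R f) = E (f # replicate i e @ replicate j f) (t *\<^sub>R f)"
      using deriv_family_swap_replicate[OF E \<open>open W\<close>, of "t *\<^sub>R f" f i e "replicate j f"] in_W t f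
      by (simp add: P_def)
    then show "((\<lambda>s. P i j (s *\<^sub>R f)) has_real_derivative P i (Suc j) (t *\<^sub>R f)) (at t)"
      using deriv_family_along_curve[OF E _ line, where ds = "replicate i e @ replicate j f"] in_W t f
      by (simp add: P_def)
  next
    fix t :: real assume t: "\<bar>t\<bar> < \<delta>"
    \<comment> \<open>On this axis the latitude is 0, so the cosine is 1 and the sine is 0.\<close>
    show "0 \<le> P 0 2 (t *\<^sub>R e) * P 2 0 (t *\<^sub>R e) - (P 1 1 (t *\<^sub>R e))\<^sup>2"
      using det[of "t *\<^sub>R e"] t e by simp
    show "0 \<le> (cos t)\<^sup>2 * P 0 2 (t *\<^sub>R f) * (P 2 0 (t *\<^sub>R f) - sin t * cos t * P 0 1 (t *\<^sub>R f))
        - (cos t * P 1 1 (t *\<^sub>R f) + sin t * P 1 0 (t *\<^sub>R f))\<^sup>2"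
      using det[of "t *\<^sub>R f"] t f unit by simp
    show "P 0 0 (t *\<^sub>R f) * ((cos t)\<^sup>2 * P 0 2 (t *\<^sub>R f) + (P 2 0 (t *\<^sub>R f) - sin t * cos t * P 0 1 (t *\<^sub>R f)))
        + c * ((cos t)\<^sup>2 * (P 0 1 (t *\<^sub>R f))\<^sup>2 + (P 1 0 (t *\<^sub>R f))\<^sup>2) + d * (cos t)\<^sup>2 = 0"
      using eq[of "t *\<^sub>R f"] t f unit by simp
  next
    \<comment> \<open>At the centre of the chart the frame \<open>n\<close>, \<open>k\<close> is
      \<open>e\<close>, \<open>f\<close>, so the vanishing entries are instances of
      \<open>null\<close>.\<close>
    note part = geo_chart_partials[OF D \<open>open U\<close> E W_def \<open>open W\<close> ED unit(2-4) in_W[of 0]]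
    show "P 0 2 (0 *\<^sub>R f) = 0"
      using part(5) null[OF tan(2)] \<open>\<delta> > 0\<close> \<Xi>0 unit by (simp add: P)
    show "P 1 1 (0 *\<^sub>R f) = 0"
      using part(4) null[OF tan(1)] \<open>\<delta> > 0\<close> \<Xi>0 unit P by simp
    show "0 < P 0 0 (0 *\<^sub>R f)"
      using pos[OF q] v[OF q] \<Xi>0 by (simp add: P ED)
  qed simp
qed

theorem theorem5p1:
  fixes \<Omega> :: "(real^3) set" and u :: "real^3 \<Rightarrow> real" and p :: real and v :: "real^3 \<Rightarrow> real"
  assumes dom: "smooth_domain_S2 \<Omega>"
    and p_range: "(0 \<le> p \<and> p < 1) \<or> (1 < p \<and> p \<le> 3)"
    and u_smooth: "smooth_on_closure \<Omega> u"
    and eq: "\<forall>x\<in>\<Omega>. - lb_laplacian u x = u x powr p"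
    and pos: "\<forall>x\<in>\<Omega>. u x > 0"
    and bdry: "\<forall>x\<in>closure \<Omega> - \<Omega>. u x = 0"
    and v_def: "v = (\<lambda>x. u x powr ((1 - p) / 2))"
    and case_a: "p < 1 \<Longrightarrow> \<forall>x\<in>\<Omega>. \<forall>X\<in>tangent_S2 x. cov_hess v x X X \<le> 0"
    and case_b: "p > 1 \<Longrightarrow> \<forall>x\<in>\<Omega>. \<forall>X\<in>tangent_S2 x. cov_hess v x X X \<ge> 0"
  shows "\<exists>r. \<forall>x\<in>\<Omega>. hess_rank v x = r"
proof (intro exI ballI)
  fix q assume q: "q \<in> \<Omega>"
  have \<Omega>: "openin (top_of_set S2) \<Omega>" using dom by (simp add: smooth_domain_S2_def)
  obtain U0 g where "open U0" "closure \<Omega> \<subseteq> U0" "smooth_on U0 g" and g: "\<forall>x\<in>closure \<Omega>. g x = u x"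
    using u_smooth by (auto simp: smooth_on_closure_def)
  then obtain D where D0: "deriv_family U0 D" and Dg: "\<forall>x\<in>U0. D [] x = g x"
    by (auto simp: smooth_on_iff_deriv_family)
  \<comment> \<open>Restricting to where the extension of \<open>u\<close> is positive makes its
    real powers smooth.\<close>
  define U where "U = U0 \<inter> D [] -` {0<..}"
  have "continuous_on U0 (D [])"
    using deriv_family_isCont[OF D0] by (simp add: continuous_at_imp_continuous_on)
  then have "open U"
    unfolding U_def by (intro continuous_open_preimage \<open>open U0\<close>) auto
  have D: "deriv_family U D" using D0 by (rule deriv_family_subset) (auto simp: U_def)
  have Du: "D [] y = u y" if "y \<in> \<Omega>" for y
    using that closure_subset \<open>closure \<Omega> \<subseteq> U0\<close> Dg g by (metis subsetD)
  have \<Omega>U: "\<Omega> \<subseteq> U"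
    using closure_subset \<open>closure \<Omega> \<subseteq> U0\<close> Du pos by (fastforce simp: U_def)
  have Dpos: "D [] y > 0" if "y \<in> U" for y using that by (simp add: U_def)
  define \<gamma> where "\<gamma> = (1 - p) / 2"
  have "\<gamma> \<noteq> 0" using p_range by (auto simp: \<gamma>_def)
  obtain E where E: "deriv_family U E" and ED: "E [] = (\<lambda>x. D [] x powr \<gamma>)"
    using deriv_family_powr[OF D Dpos] by blast
  have Ev: "E [] y = v y" if "y \<in> \<Omega>" for y
    using Du[OF that] by (simp add: ED v_def \<gamma>_def)
  \<comment> \<open>For negative \<gamma> the bound by -2 amounts to
    \<open>- 1 \<le> \<gamma>\<close>, that is, to \<open>p \<le> 3\<close>.\<close>
  have cd: "(0 \<le> (1 - \<gamma>) / \<gamma> \<and> 0 < \<gamma>) \<or> ((1 - \<gamma>) / \<gamma> \<le> -2 \<and> \<gamma> < 0)"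
    using p_range
  proof
    assume "0 \<le> p \<and> p < 1"
    then have "0 < \<gamma>" "\<gamma> \<le> 1" by (auto simp: \<gamma>_def)
    then show ?thesis by simp
  next
    assume "1 < p \<and> p \<le> 3"
    then have "\<gamma> < 0" "- 1 \<le> \<gamma>" by (auto simp: \<gamma>_def)
    then show ?thesis by (simp add: divide_simps)
  qed
  have "X = 0" if X: "X \<in> tangent_S2 q" "\<forall>Y\<in>tangent_S2 q. cov_hess v q X Y = 0" for X
  proof (rule cov_hess_nondegenerate[OF E \<open>open U\<close> \<Omega> \<Omega>U Ev _ _ _ cd q X])
    fix y assume y: "y \<in> \<Omega>"
    show "0 < v y" using pos y by (force simp: v_def)
    show "(\<forall>Z\<in>tangent_S2 y. cov_hess v y Z Z \<le> 0) \<or> (\<forall>Z\<in>tangent_S2 y. 0 \<le> cov_hess v y Z Z)"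
      using p_range case_a case_b y by blast
    fix a b :: "real^3"
    assume ab: "norm a = 1" "norm b = 1" "a \<bullet> y = 0" "b \<bullet> y = 0" "a \<bullet> b = 0"
    have "D [a, a] y + D [b, b] y - 2 * D [y] y = - (D [] y powr p)"
      using lb_laplacian_eq[OF D \<open>open U\<close> \<Omega> \<Omega>U Du y ab] eq y Du[OF y] by force
    then show "E [] y * (E [a, a] y + E [b, b] y - 2 * E [y] y)
        + (1 - \<gamma>) / \<gamma> * ((E [a] y)\<^sup>2 + (E [b] y)\<^sup>2) + \<gamma> = 0"
      using powr_equation[OF D \<open>open U\<close> Dpos E ED \<gamma>_def \<open>\<gamma> \<noteq> 0\<close>] y \<Omega>U by blast
  qed
  then have "{X \<in> tangent_S2 q. \<forall>Y\<in>tangent_S2 q. cov_hess v q X Y = 0} \<subseteq> {0}" by blast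
  then have "dim {X \<in> tangent_S2 q. \<forall>Y\<in>tangent_S2 q. cov_hess v q X Y = 0} = 0"
    by (simp only: dim_eq_0)
  \<comment> \<open>The kernel is trivial, so the constant rank, left open until here, is 2.\<close>
  then show "hess_rank v q = 2" by (simp only: hess_rank_def diff_zero)
qed

end
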